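(* Consider $N\ge3$ robotic agents rigidly grasping an object, with the coupled object-agents dynamics described in the context, in a nondegenerate configuration $x$. Let $h_{O,\mathrm{d}}\in\mathbb{R}^6$ be a desired force to be applied to the object, which is distributed to the agents' desired forces as $h_{\mathrm{d}}=G^\ast h_{O,\mathrm{d}}$, where $G^\ast\in\mathbb{R}^{6N\times6}$ is a right inverse of the grasp matrix $G$, i.e. $GG^\ast=I_6$. Let $h_{\mathrm{int}}$ be the internal forces resulting when the agents' forces are $h=h_{\mathrm{d}}$. Then $$h_{\mathrm{int}}=0\quad\Longleftrightarrow\quad G^\ast=MG^\top(GMG^\top)^{-1}.$$
   Context: For $a\in\mathbb{R}^3$, $S(a)$ is the skew-symmetric matrix with $S(a)b=a\times b$; for nonzero $y\in\mathbb{R}^n$, $P_r(y)=I_n-\frac{yy^\top}{\|y\|^2}$; $A^\dagger$ is the Moore-Penrose inverse. Kinematics: agent $i\in\{1,\dots,N\}$ has end-effector position $p_i\in\mathbb{R}^3$, orientation $R_i\in\mathsf{SO}(3)$ and velocity $v_i=[\dot p_i^\top,\omega_i^\top]^\top$ with $\dot R_i=S(\omega_i)R_i$; $x=((p_1,R_1),\dots,(p_N,R_N))\in\mathsf{SE}(3)^N$ and $v=[v_1^\top,\dots,v_N^\top]^\top$. The object's center of mass has position $p_O$, orientation $R_O\in\mathsf{SO}(3)$ and velocity $v_O=[\dot p_O^\top,\omega_O^\top]^\top\in\mathbb{R}^6$ with $\dot R_O=S(\omega_O)R_O$. Grasp matrix: $G=[J_{O_1}^\top,\dots,J_{O_N}^\top]\in\mathbb{R}^{6\times6N}$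 with $J_{O_i}=\begin{bmatrix} I_3 & -S(p_i-p_O)\\ 0_{3\times3}& I_3\end{bmatrix}$; it has full row rank. Dynamics: the agents satisfy $M\dot v+Cv+g=u-h$, the object satisfies $M_O\dot v_O+C_Ov_O+g_O=h_O$, with $h_O=Gh$, and grasp rigidity gives $v=G^\top v_O$, hence $\dot v=G^\top\dot v_O+\dot G^\top v_O$. Here $M\in\mathbb{R}^{6N\times6N}$ (agent inertia) and $M_O\in\mathbb{R}^{6\times6}$ (object inertia) are symmetric positive definite, $C,C_O$ are Coriolis matrices, $g,g_O$ gravity vectors (all determined by the state), $u\in\mathbb{R}^{6N}$ is the task-space input and $h\in\mathbb{R}^{6N}$ the vector of agent forces at the grasping points. Eliminating $h$ gives the coupled dynamics $(M_O+GMG^\top)\dot v_O+(C_O+GCG^\top+GM\dot G^\top)v_O+g_O+Gg=Gu$. At a given state, prescribing $h=h_{\mathrm{d}}$ determines $\dot v_O$, $\dot v$ and $u$ through these equations. Rigidity matrix: configurations have pairwise distinct positions. The complete graph $\mathcal{G}=\mathcal{K}_N$ has edge set $\mathcal{E}=\{(i,j): i\ne j\}$, and $\mathcal{E}_u=\{(i,j)\in\mathcal{E}: i<j\}$. With $\gamma_{e,b}=R_i^\top\frac{p_j-p_i}{\|p_i-p_j\|}$ for $e=(i,j)$, the distance-and-bearing rigidity matrix $\mathcal{R}_{\mathcal{G}}(x)\in\mathbb{R}^{(|\mathcal{E}_u|+3|\mathcal{E}|)\times6N}$ has columns grouped in $N$ blocks of six (three for $\dot p_k$, then three for $\omega_k$).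 For each $e=(i,j)\in\mathcal{E}_u$ it has one row with block $i$ equal to $[(p_i-p_j)^\top\ 0_{1\times3}]$, block $j$ equal to $[(p_j-p_i)^\top\ 0_{1\times3}]$ and other blocks zero. For each $e=(i,j)\in\mathcal{E}$ it has three rows with block $i$ equal to $\left[-\frac{P_r(\gamma_{e,b})}{\|p_j-p_i\|}R_i^\top\ \ S(\gamma_{e,b})R_i^\top\right]$, block $j$ equal to $\left[\frac{P_r(\gamma_{e,b})}{\|p_j-p_i\|}R_i^\top\ \ 0_{3\times3}\right]$ and other blocks zero. $\dot{\mathcal{R}}_{\mathcal{G}}$ and $\dot G$ denote time derivatives along the motion (determined by the state). Internal forces: $h_{\mathrm{int}}=M^{\frac12}(\mathcal{R}_{\mathcal{G}}M^{-\frac12})^\dagger(\dot{\mathcal{R}}_{\mathcal{G}}v+\mathcal{R}_{\mathcal{G}}\alpha)$ with $\alpha=M^{-1}(u-Cv-g)$. Nondegenerate: $\mathrm{rank}(\mathcal{R}_{\mathcal{G}}(x))=\max_y\mathrm{rank}(\mathcal{R}_{\mathcal{G}}(y))$, the maximum being over all $y\in\mathsf{SE}(3)^N$ with pairwise distinct positions.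
   Formalization: The left side is read as "h_int = 0 for every desired force h_{O,d}": for one fixed h_{O,d} the implication to G* = MG^T(GMG^T)^{-1} is false, e.g. for h_{O,d} = 0, where h_int = 0 for every right inverse G*. *)

theory Defs
  imports "HOL-Analysis.Analysis"
begin

section \<open>Linear algebra\<close>

definition skew :: "real^3 \<Rightarrow> real^3^3" where
  "skew a = matrix (\<lambda>b. cross3 a b)"

definition proj_perp :: "real^'k \<Rightarrow> real^'k^'k" where
  "proj_perp y = mat 1 - (1 / (norm y)\<^sup>2) *\<^sub>R (\<chi> a b. y $ a * y $ b)"

definition moore_penrose :: "real^'n^'m \<Rightarrow> real^'m^'n \<Rightarrow> bool" where
  "moore_penrose A X \<longleftrightarrow>
     A ** X ** A = A \<and> X ** A ** X = X \<and>
     transpose (A ** X) = A ** X \<and> transpose (X ** A) = X ** A"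

definition pinv :: "real^'n^'m \<Rightarrow> real^'m^'n" where
  "pinv A = (THE X. moore_penrose A X)"

definition spd :: "real^'k^'k \<Rightarrow> bool" where
  "spd A \<longleftrightarrow> transpose A = A \<and> (\<forall>y. y \<noteq> 0 \<longrightarrow> y \<bullet> (A *v y) > 0)"

text \<open>Principal square root; only meaningful for symmetric positive definite arguments.\<close>

definition msqrt :: "real^'k^'k \<Rightarrow> real^'k^'k" where
  "msqrt A = (THE X. spd X \<and> X ** X = A)"

text \<open>Block matrices. Sum types index the concatenation of two blocks, product types
  \<^typ>\<open>'k \<times> 'b\<close> index a family of blocks of common size, one for each element of \<^typ>\<open>'k\<close>.\<close>

definition hcat :: "real^'a::finite^'r \<Rightarrow> real^'b::finite^'r \<Rightarrow> real^('a + 'b)^'r" where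
  "hcat A B = (\<chi> r c. case c of Inl a \<Rightarrow> A $ r $ a | Inr b \<Rightarrow> B $ r $ b)"

definition vcat :: "real^'c^'a::finite \<Rightarrow> real^'c^'b::finite \<Rightarrow> real^'c^('a + 'b)" where
  "vcat A B = (\<chi> r. case r of Inl a \<Rightarrow> A $ a | Inr b \<Rightarrow> B $ b)"

definition block_row :: "('k::finite \<Rightarrow> real^'b::finite^'r) \<Rightarrow> real^('k \<times> 'b)^'r" where
  "block_row A = (\<chi> r c. A (fst c) $ r $ snd c)"

definition block_col :: "('k::finite \<Rightarrow> real^'c^'b::finite) \<Rightarrow> real^'c^('k \<times> 'b)" where
  "block_col A = (\<chi> r. A (fst r) $ snd r)"


section \<open>Configurations and velocities\<close>

text \<open>Agents are the elements of a finite linearly ordered type \<^typ>\<open>'n\<close>; the order plays the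
  role of that of \<open>{1,\<dots>,N}\<close>. Membership in the special Euclidean group is imposed by
  \<open>SE3\<close> below, so that the ambient type is a vector space in which one can differentiate.\<close>

type_synonym 'n config = "((real^3) \<times> (real^3^3))^'n"

text \<open>A twist or wrench: linear part, then angular part; and the stacked version for all agents.\<close>

type_synonym vec6 = "real^(3 + 3)"
type_synonym mat6 = "real^(3 + 3)^(3 + 3)"
type_synonym 'n vec6N = "real^('n::finite \<times> (3 + 3))"
type_synonym 'n mat6N = "real^('n::finite \<times> (3 + 3))^('n \<times> (3 + 3))"

definition pos :: "'n::finite config \<Rightarrow> 'n \<Rightarrow> real^3" where
  "pos x k = fst (x $ k)"

definition ori :: "'n::finite config \<Rightarrow> 'n \<Rightarrow> real^3^3" where
  "ori x k = snd (x $ k)"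

definition SE3 :: "'n::finite config set" where
  "SE3 = {x. \<forall>k. rotation_matrix (ori x k)}"

definition distinct_pos :: "'n::finite config set" where
  "distinct_pos = {x. inj (pos x)}"

definition lin6 :: "vec6 \<Rightarrow> real^3" where
  "lin6 w = (\<chi> a. w $ Inl a)"

definition lin_part :: "'n::finite vec6N \<Rightarrow> 'n \<Rightarrow> real^3" where
  "lin_part v k = (\<chi> a. v $ (k, Inl a))"

definition ang_part :: "'n::finite vec6N \<Rightarrow> 'n \<Rightarrow> real^3" where
  "ang_part v k = (\<chi> a. v $ (k, Inr a))"

definition config_rate :: "'n::finite config \<Rightarrow> 'n vec6N \<Rightarrow> 'n config" where
  "config_rate x v = (\<chi> k. (lin_part v k, skew (ang_part v k) ** ori x k))"


section \<open>Grasp matrix\<close>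

definition grasp_jac :: "'n::finite config \<Rightarrow> real^3 \<Rightarrow> 'n \<Rightarrow> mat6" where
  "grasp_jac x pO i = vcat (hcat (mat 1) (- skew (pos x i - pO))) (hcat 0 (mat 1))"

definition grasp :: "'n::finite config \<Rightarrow> real^3 \<Rightarrow> real^('n \<times> (3 + 3))^(3 + 3)" where
  "grasp x pO = block_row (\<lambda>i. transpose (grasp_jac x pO i))"

text \<open>The time derivative along the motion, expressed by the chain rule as the derivative at the
  current state in the direction of the current velocity. The same is done for the rigidity
  matrix below.\<close>

definition grasp_dot ::
  "'n::finite config \<Rightarrow> real^3 \<Rightarrow> 'n vec6N \<Rightarrow> vec6 \<Rightarrow> real^('n \<times> (3 + 3))^(3 + 3)" where
  "grasp_dot x pO v vO =
     frechet_derivative (\<lambda>(y, q). grasp y q) (at (x, pO)) (config_rate x v, lin6 vO)"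


section \<open>Rigidity matrix of the complete graph\<close>

text \<open>The class \<^class>\<open>card2\<close> (at least two elements) only serves to make the edge types
  inhabited.\<close>

typedef (overloaded) 'n edge = "{(i, j). i \<noteq> (j :: 'n :: card2)}"
proof -
  have "\<not> is_singleton (UNIV :: 'n set)"
    using two_le_card[where 'a = 'n] by (auto simp: is_singleton_altdef)
  then obtain i j :: 'n where "i \<noteq> j"
    by (metis UNIV_I is_singletonI' empty_iff)
  then show ?thesis by auto
qed

typedef (overloaded) 'n uedge = "{(i, j). i < (j :: 'n :: {card2, linorder})}"
proof -
  have "\<not> is_singleton (UNIV :: 'n set)"
    using two_le_card[where 'a = 'n] by (auto simp: is_singleton_altdef)
  then obtain i j :: 'n where "i \<noteq> j"
    by (metis UNIV_I is_singletonI' empty_iff)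
  then show ?thesis by (cases i j rule: linorder_cases) auto
qed

instance edge :: (card2) finite
proof
  show "finite (UNIV :: 'a edge set)"
    by (rule finite_imageD[of Rep_edge]) (auto simp: inj_on_def Rep_edge_inject)
qed

instance uedge :: ("{card2, linorder}") finite
proof
  show "finite (UNIV :: 'a uedge set)"
    by (rule finite_imageD[of Rep_uedge]) (auto simp: inj_on_def Rep_uedge_inject)
qed

definition bearing :: "'n::finite config \<Rightarrow> 'n \<Rightarrow> 'n \<Rightarrow> real^3" where
  "bearing x i j =
     transpose (ori x i) *v ((1 / norm (pos x i - pos x j)) *\<^sub>R (pos x j - pos x i))"

definition distance_row :: "'n::finite config \<Rightarrow> 'n \<times> 'n \<Rightarrow> real^('n \<times> (3 + 3))^1" where
  "distance_row x = (\<lambda>(i, j). block_row (\<lambda>k.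
     if k = i then hcat (rowvector (pos x i - pos x j)) 0
     else if k = j then hcat (rowvector (pos x j - pos x i)) 0
     else 0))"

definition bearing_rows :: "'n::finite config \<Rightarrow> 'n \<times> 'n \<Rightarrow> real^('n \<times> (3 + 3))^3" where
  "bearing_rows x = (\<lambda>(i, j).
     let \<gamma> = bearing x i j;
         B = (1 / norm (pos x j - pos x i)) *\<^sub>R (proj_perp \<gamma> ** transpose (ori x i))
     in block_row (\<lambda>k.
          if k = i then hcat (- B) (skew \<gamma> ** transpose (ori x i))
          else if k = j then hcat B 0
          else 0))"

definition rigidity ::
  "'n::{card2, linorder} config \<Rightarrow> real^('n \<times> (3 + 3))^('n uedge \<times> 1 + 'n edge \<times> 3)" where
  "rigidity x = vcat (block_col (\<lambda>e. distance_row x (Rep_uedge e)))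
                     (block_col (\<lambda>e. bearing_rows x (Rep_edge e)))"

definition rigidity_dot ::
  "'n::{card2, linorder} config \<Rightarrow> 'n vec6N
     \<Rightarrow> real^('n \<times> (3 + 3))^('n uedge \<times> 1 + 'n edge \<times> 3)" where
  "rigidity_dot x v = frechet_derivative rigidity (at x) (config_rate x v)"

definition nondegenerate :: "'n::{card2, linorder} config \<Rightarrow> bool" where
  "nondegenerate x \<longleftrightarrow> rank (rigidity x) =
     Max ((\<lambda>y. rank (rigidity y)) ` (SE3 \<inter> distinct_pos :: 'n config set))"


section \<open>Dynamics and internal forces\<close>

text \<open>The equations of motion at a state with velocities \<open>v\<close>, \<open>vO\<close>; \<open>dv\<close> and \<open>dvO\<close> are the
  accelerations, \<open>u\<close> the input and \<open>h\<close> the agents' forces. Grasp rigidity at the velocity level,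
  \<open>v = G\<^sup>T vO\<close>, constrains the state and is not part of this predicate.\<close>

definition grasp_dynamics ::
  "'n::finite mat6N \<Rightarrow> 'n mat6N \<Rightarrow> 'n vec6N \<Rightarrow> mat6 \<Rightarrow> mat6 \<Rightarrow> vec6
     \<Rightarrow> real^('n \<times> (3 + 3))^(3 + 3) \<Rightarrow> real^('n \<times> (3 + 3))^(3 + 3)
     \<Rightarrow> 'n vec6N \<Rightarrow> vec6 \<Rightarrow> 'n vec6N \<Rightarrow> vec6 \<Rightarrow> 'n vec6N \<Rightarrow> 'n vec6N \<Rightarrow> bool" where
  "grasp_dynamics M C g MO CO gO G dG v vO dv dvO u h \<longleftrightarrow>
     M *v dv + C *v v + g = u - h \<and>
     MO *v dvO + CO *v vO + gO = G *v h \<and>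
     dv = transpose G *v dvO + transpose dG *v vO"

definition internal_force ::
  "'n::{card2, linorder} mat6N \<Rightarrow> 'n mat6N \<Rightarrow> 'n vec6N \<Rightarrow> 'n config \<Rightarrow> 'n vec6N \<Rightarrow> 'n vec6N
     \<Rightarrow> 'n vec6N" where
  "internal_force M C g x v u =
     (let \<alpha> = matrix_inv M *v (u - C *v v - g)
      in msqrt M *v (pinv (rigidity x ** matrix_inv (msqrt M)) *v
           (rigidity_dot x v *v v + rigidity x *v \<alpha>)))"

end

theory Submission
  imports Defs
begin

text \<open>
  Rigid motions preserve distances and body-frame bearings, so \<open>\<R> G\<^sup>T = 0\<close> on \<open>SE(3)\<^sup>N\<close>;
  differentiating this identity along the motion gives \<open>\<R>' v + \<R> dv = 0\<close> for the constrained
  accelerations. Since \<open>\<alpha> = dv + M\<^sup>-\<^sup>1 h\<close>, the internal force vanishes iff \<open>\<R> M\<^sup>-\<^sup>1 h = 0\<close>.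
  At a configuration without collinear triples the kernel of \<open>\<R>\<close> consists of rigid motions only,
  hence has dimension 6; by rank-nullity every nondegenerate configuration has
  \<open>ker \<R> = range G\<^sup>T\<close>. Thus the condition reads \<open>G\<^sup>* = M G\<^sup>T Y\<close> for some \<open>Y\<close>, and \<open>G G\<^sup>* = I\<close>
  forces \<open>Y = (G M G\<^sup>T)\<^sup>-\<^sup>1\<close>.
\<close>

section \<open>Symmetric matrices, square roots and pseudoinverses\<close>

text \<open>The equivalence concerns all desired forces at once: for \<open>hOd = 0\<close> the
  agents' forces vanish, and with them the internal force, whatever \<open>Gstar\<close> is. Letting
  \<open>hOd\<close> range over all vectors turns the condition on \<open>h\<close> into a condition
  on the matrix \<open>Gstar\<close>.

  \<open>msqrt\<close> and \<open>pinv\<close> are definite descriptions and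
  \<open>frechet_derivative\<close> is a choice operator, so none of them can be used before
  existence is known. This is why the spectral theorem and a differentiability calculus come in.

  The pseudoinverse loses no information here: its argument reduces to
  \<open>(R M^(-1/2)) (M^(-1/2) h)\<close>, which lies in the range of the matrix being inverted,
  and there the pseudoinverse is injective.

  Nondegeneracy is only a statement about a maximal rank and gives no direct geometric information
  about \<open>x\<close>. One explicit comparison configuration, with all orientations equal to the
  identity, suffices to bound the kernel at \<open>x\<close>.\<close>

lemma inner_transpose_matrix:
  fixes A :: "real^'n^'m"
  shows "x \<bullet> (A *v y) = (transpose A *v x) \<bullet> y"
  by (simp add: dot_lmul_matrix)

section \<open>Spectral theorem for symmetric matrices\<close>

lemma nonneg_quadratic_linear_zero:
  fixes b c :: real
  assumes "\<And>t. 0 \<le> 2 * t * b + t\<^sup>2 * c"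
  shows "b = 0"
proof (rule ccontr)
  assume "b \<noteq> 0"
  then have b: "b\<^sup>2 > 0" by simp
  have c: "0 \<le> c" using assms[of 1] assms[of "-1"] by simp
  \<comment> \<open>Near zero the linear term dominates. The point \<open>- s * b\<close> yields
    \<open>s * b\<^sup>2 * (s * c - 2)\<close>; the summand 1 keeps the denominator positive when
    \<open>c = 0\<close> and ensures \<open>s * c \<le> 1\<close>.\<close>
  define s where "s = 1 / (c + 1)"
  have s: "s > 0" "s * c \<le> 1" using c by (simp_all add: s_def field_simps)
  have "0 \<le> 2 * (- s * b) * b + (- s * b)\<^sup>2 * c" by (rule assms)
  also have "\<dots> = s * b\<^sup>2 * (s * c - 2)" by (simp add: power2_eq_square algebra_simps)
  also have "\<dots> < 0" using b s by (intro mult_pos_neg) auto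
  finally show False by simp
qed

text \<open>A maximiser of the quadratic form on the unit sphere of an invariant subspace is an
  eigenvector.\<close>

lemma symmetric_matrix_eigenvector_in_subspace:
  fixes A :: "real^'n^'n"
  assumes A: "transpose A = A" and S: "subspace S" and inv: "\<And>x. x \<in> S \<Longrightarrow> A *v x \<in> S"
    and ne: "z \<in> S" "z \<noteq> 0"
  obtains e c where "e \<in> S" "norm e = 1" "A *v e = c *\<^sub>R e"
proof -
  let ?K = "S \<inter> sphere 0 1"
  have "compact ?K" by (intro closed_Int_compact closed_subspace S compact_sphere)
  moreover have "z /\<^sub>R norm z \<in> ?K" using ne S by (simp add: subspace_scale)
  then have "?K \<noteq> {}" by blast
  moreover have "continuous_on ?K (\<lambda>x. x \<bullet> (A *v x))"
    by (intro continuous_intros matrix_vector_mult_linear_continuous_on)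
  ultimately obtain e where e: "e \<in> ?K" and max: "\<And>y. y \<in> ?K \<Longrightarrow> y \<bullet> (A *v y) \<le> e \<bullet> (A *v e)"
    using continuous_attains_sup[of ?K "\<lambda>x. x \<bullet> (A *v x)"] by blast
  define c where "c = e \<bullet> (A *v e)"
  \<comment> \<open>Homogeneous form of maximality: \<open>q\<close> is nonnegative on
    \<open>S\<close> and vanishes at \<open>e\<close>, so its first variation there, a multiple of
    \<open>(c e - A e) . y\<close>, is zero for every \<open>y\<close> in \<open>S\<close>. By
    invariance \<open>y = c e - A e\<close> is allowed.\<close>
  define q where "q y = c * (y \<bullet> y) - y \<bullet> (A *v y)" for y
  have sym: "x \<bullet> (A *v y) = (A *v x) \<bullet> y" for x y
    by (simp only: inner_transpose_matrix A)
  have ee: "e \<bullet> e = 1" using e by (simp add: norm_eq_1)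
  have qnn: "0 \<le> q y" if y: "y \<in> S" for y
  proof (cases "y = 0")
    case False
    have "(y /\<^sub>R norm y) \<bullet> (A *v (y /\<^sub>R norm y)) \<le> c"
      unfolding c_def by (rule max) (use False y S in \<open>simp add: subspace_scale\<close>)
    then have "y \<bullet> (A *v y) / (norm y)\<^sup>2 \<le> c"
      by (simp add: matrix_vector_mult_scaleR power2_eq_square divide_inverse mult_ac)
    then have "y \<bullet> (A *v y) \<le> c * (norm y)\<^sup>2"
      using False by (simp add: pos_divide_le_eq)
    then show ?thesis by (simp add: q_def dot_square_norm)
  qed (simp add: q_def)
  have orth: "(c *\<^sub>R e - A *v e) \<bullet> y = 0" if y: "y \<in> S" for y
  proof (rule nonneg_quadratic_linear_zero)
    fix t :: real
    have "0 \<le> q (e + t *\<^sub>R y)"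
      using e y S by (intro qnn) (simp add: subspace_add subspace_scale)
    also have "q (e + t *\<^sub>R y) = 2 * t * ((c *\<^sub>R e - A *v e) \<bullet> y) + t\<^sup>2 * q y"
    proof -
      have "q (e + t *\<^sub>R y) = c * (e \<bullet> e) - e \<bullet> (A *v e)
          + t * (2 * c * (e \<bullet> y) - e \<bullet> (A *v y) - (A *v e) \<bullet> y) + t\<^sup>2 * q y"
        by (simp add: q_def matrix_vector_right_distrib matrix_vector_mult_scaleR inner_add_left
            inner_add_right inner_commute power2_eq_square algebra_simps)
      also have "\<dots> = 2 * t * ((c *\<^sub>R e - A *v e) \<bullet> y) + t\<^sup>2 * q y"
        by (simp add: sym[of e y] ee c_def[symmetric] inner_diff_left algebra_simps)
      finally show ?thesis .
    qed
    finally show "0 \<le> 2 * t * ((c *\<^sub>R e - A *v e) \<bullet> y) + t\<^sup>2 * q y" .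
  qed
  have "c *\<^sub>R e - A *v e \<in> S"
    using e inv S by (simp add: subspace_diff subspace_scale)
  from orth[OF this] have "A *v e = c *\<^sub>R e" by simp
  with e show thesis by (intro that) auto
qed

text \<open>A largest orthonormal set of eigenvectors is a basis: otherwise its orthogonal
  complement is nonzero and, by symmetry, invariant under \<open>A\<close>, so it contains one more
  unit eigenvector.\<close>

lemma symmetric_matrix_eigenbasis:
  fixes A :: "real^'n^'n"
  assumes A: "transpose A = A"
  obtains B where "card B = CARD('n)" "finite B" "pairwise orthogonal B"
    "\<And>b. b \<in> B \<Longrightarrow> norm b = 1" "\<And>b. b \<in> B \<Longrightarrow> \<exists>c. A *v b = c *\<^sub>R b"
proof -
  define P where "P B \<longleftrightarrow> finite B \<and> pairwise orthogonal B \<and> (\<forall>b\<in>B. norm b = 1 \<and> (\<exists>c. A *v b = c *\<^sub>R b))"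
    for B
  have indep: "independent B" if "P B" for B
    using that by (intro pairwise_orthogonal_independent) (auto simp: P_def)
  have bound: "card B \<le> CARD('n)" if "P B" for B
    using independent_bound[OF indep[OF that]] by simp
  have "P {}" by (simp add: P_def)
  then obtain B where B: "P B" and max: "\<And>B'. P B' \<Longrightarrow> card B' \<le> card B"
    using ex_has_greatest_nat[of P "{}" card "Suc CARD('n)"] bound
    by (metis less_Suc_eq_le)
  have "card B = CARD('n)"
  proof (rule ccontr)
    assume "card B \<noteq> CARD('n)"
    then have "card B < CARD('n)" using bound[OF B] by simp
    then have "dim B < DIM(real^'n)" using indep[OF B] by (simp add: dim_eq_card_independent)
    then obtain z where z: "z \<noteq> 0" "\<And>b. b \<in> span B \<Longrightarrow> orthogonal z b"
      using orthogonal_to_subspace_exists by blast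
    define S where "S = {y. \<forall>b\<in>B. y \<bullet> b = 0}"
    have S: "subspace S" by (auto simp: S_def subspace_def inner_add_left)
    have zS: "z \<in> S" using z(2) by (auto simp: S_def orthogonal_def span_base)
    have inv: "A *v y \<in> S" if y: "y \<in> S" for y
      unfolding S_def
    proof safe
      fix b assume b: "b \<in> B"
      with B obtain c where "A *v b = c *\<^sub>R b" by (auto simp: P_def)
      moreover have "(A *v y) \<bullet> b = y \<bullet> (A *v b)" by (simp only: inner_transpose_matrix A)
      ultimately show "(A *v y) \<bullet> b = 0" using y b by (simp add: S_def)
    qed
    obtain e c where e: "e \<in> S" "norm e = 1" "A *v e = c *\<^sub>R e"
      using symmetric_matrix_eigenvector_in_subspace[OF A S inv zS z(1)] by blast
    have "e \<notin> B" using e by (auto simp: S_def norm_eq_1)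
    moreover have "P (insert e B)"
      using B e by (auto simp: P_def pairwise_insert orthogonal_def S_def inner_commute)
    ultimately show False using max[of "insert e B"] B by (simp add: P_def)
  qed
  with B show thesis by (intro that[of B]) (auto simp: P_def)
qed

definition diag_mat :: "('n \<Rightarrow> real) \<Rightarrow> real^'n^'n" where
  "diag_mat d = (\<chi> i j. if i = j then d i else 0)"

lemma transpose_diag_mat [simp]: "transpose (diag_mat a) = diag_mat a"
  by (auto simp: diag_mat_def transpose_def vec_eq_iff)

lemma diag_mat_vec: "(diag_mat a *v y) $ i = a i * y $ i"
proof -
  have "(diag_mat a *v y) $ i = (\<Sum>j\<in>UNIV. if j = i then a i * y $ i else 0)"
    unfolding matrix_vector_mult_def diag_mat_def vec_lambda_beta by (rule sum.cong) auto
  then show ?thesis by simp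
qed

lemma diag_mat_mult: "diag_mat a ** diag_mat b = diag_mat (\<lambda>i. a i * b i)"
  by (simp add: matrix_eq matrix_vector_mul_assoc[symmetric] vec_eq_iff diag_mat_vec mult.assoc)

lemma symmetric_matrix_diagonalization:
  fixes A :: "real^'n^'n"
  assumes A: "transpose A = A"
  obtains Q d where "orthogonal_matrix Q" "A = Q ** diag_mat d ** transpose Q"
proof -
  obtain B where B: "card B = CARD('n)" "finite B" "pairwise orthogonal B"
    "\<And>b. b \<in> B \<Longrightarrow> norm b = 1" "\<And>b. b \<in> B \<Longrightarrow> \<exists>c. A *v b = c *\<^sub>R b"
    using symmetric_matrix_eigenbasis[OF A] by blast
  obtain f where f: "bij_betw f (UNIV :: 'n set) B"
    using finite_same_card_bij[of "UNIV :: 'n set" B] B by auto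
  define Q :: "real^'n^'n" where "Q = (\<chi> i j. f j $ i)"
  have col: "column j Q = f j" for j by (simp add: Q_def column_def vec_eq_iff)
  have fB: "f j \<in> B" for j using f by (auto simp: bij_betw_def)
  have Q: "orthogonal_matrix Q"
    unfolding orthogonal_matrix_orthonormal_columns col
  proof (intro conjI allI impI)
    fix i j :: 'n assume "i \<noteq> j"
    then have "f i \<noteq> f j" using f by (metis UNIV_I bij_betw_imp_inj_on inj_onD)
    then show "orthogonal (f i) (f j)" using B(3) fB by (simp add: pairwise_def)
  qed (simp add: B(4) fB)
  have "\<forall>j. \<exists>c. A *v f j = c *\<^sub>R f j" using B(5) fB by blast
  from choice[OF this] obtain d where d: "\<And>j. A *v f j = d j *\<^sub>R f j" by blast
  have "A ** Q = Q ** diag_mat d"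
  proof -
    have "(A ** Q) $ i $ j = (A *v f j) $ i" for i j
      by (simp add: matrix_matrix_mult_def matrix_vector_mult_def Q_def)
    moreover have "(Q ** diag_mat d) $ i $ j = d j * f j $ i" for i j
    proof -
      have "(Q ** diag_mat d) $ i $ j = (\<Sum>k\<in>UNIV. if k = j then d j * f j $ i else 0)"
        unfolding matrix_matrix_mult_def diag_mat_def Q_def vec_lambda_beta by (rule sum.cong) auto
      then show ?thesis by simp
    qed
    ultimately show ?thesis by (simp add: vec_eq_iff d)
  qed
  moreover have "A = A ** Q ** transpose Q"
    using Q by (simp only: orthogonal_matrix_def matrix_mul_assoc[symmetric] matrix_mul_rid)
  ultimately have "A = Q ** diag_mat d ** transpose Q" by simp
  with Q show thesis by (rule that)
qed

lemma orthogonal_conj_mult: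
  fixes Q :: "real^'n^'n"
  assumes "orthogonal_matrix Q"
  shows "(Q ** X ** transpose Q) ** (Q ** Y ** transpose Q) = Q ** (X ** Y) ** transpose Q"
proof -
  have "(Q ** X ** transpose Q) ** (Q ** Y ** transpose Q)
      = Q ** X ** (transpose Q ** Q) ** Y ** transpose Q"
    by (simp add: matrix_mul_assoc)
  also have "\<dots> = Q ** X ** Y ** transpose Q"
    using assms by (simp only: orthogonal_matrix matrix_mul_rid)
  finally show ?thesis by (simp add: matrix_mul_assoc)
qed

section \<open>Positive definiteness in an eigenbasis and square roots\<close>

lemma orthogonal_conj_diag_vec:
  fixes Q :: "real^'n^'n"
  shows "y \<bullet> ((Q ** diag_mat d ** transpose Q) *v y) = (\<Sum>i\<in>UNIV. d i * ((transpose Q *v y) $ i)\<^sup>2)"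
proof -
  have "y \<bullet> ((Q ** diag_mat d ** transpose Q) *v y)
      = (transpose Q *v y) \<bullet> (diag_mat d *v (transpose Q *v y))"
    unfolding matrix_vector_mul_assoc[symmetric] by (rule inner_transpose_matrix)
  then show ?thesis
    by (simp add: inner_vec_def diag_mat_vec power2_eq_square mult.left_commute del: transpose_matrix_vector)
qed

lemma orthogonal_transpose_nonzero:
  fixes Q :: "real^'n^'n"
  assumes "orthogonal_matrix Q" "y \<noteq> 0"
  shows "transpose Q *v y \<noteq> 0" "Q *v y \<noteq> 0"
proof -
  have "Q *v (transpose Q *v y) = y" "transpose Q *v (Q *v y) = y"
    using assms(1) by (simp_all only: matrix_vector_mul_assoc orthogonal_matrix_def matrix_vector_mul_lid)
  then show "transpose Q *v y \<noteq> 0" "Q *v y \<noteq> 0"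
    using assms(2) by (metis matrix_vector_mult_0_right)+
qed

text \<open>In the coordinates \<open>transpose Q *v y\<close> the quadratic form is a weighted sum
  of squares; the test vectors \<open>Q *v axis i 1\<close> isolate the single weights.\<close>

lemma spd_orthogonal_conj_diag:
  fixes Q :: "real^'n^'n"
  assumes Q: "orthogonal_matrix Q"
  shows "spd (Q ** diag_mat d ** transpose Q) \<longleftrightarrow> (\<forall>i. d i > 0)"
proof safe
  fix i assume spd: "spd (Q ** diag_mat d ** transpose Q)"
  define y where "y = Q *v axis i 1"
  have "transpose Q *v y = axis i 1"
    using Q by (simp only: y_def matrix_vector_mul_assoc orthogonal_matrix matrix_vector_mul_lid)
  moreover have "y \<noteq> 0" unfolding y_def
    by (rule orthogonal_transpose_nonzero(2)[OF Q]) (simp add: axis_eq_0_iff)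
  then have "0 < y \<bullet> ((Q ** diag_mat d ** transpose Q) *v y)"
    using spd unfolding spd_def by blast
  ultimately show "d i > 0"
    unfolding orthogonal_conj_diag_vec
    by (simp add: axis_def if_distrib[of "\<lambda>x. x\<^sup>2"] if_distrib[of "(*) _"] cong: if_cong)
next
  assume d: "\<forall>i. d i > 0"
  show "spd (Q ** diag_mat d ** transpose Q)"
    unfolding spd_def orthogonal_conj_diag_vec
  proof (intro conjI allI impI)
    fix y :: "real^'n" assume "y \<noteq> 0"
    then have "transpose Q *v y \<noteq> 0" using orthogonal_transpose_nonzero(1)[OF Q] by blast
    then obtain i where "(transpose Q *v y) $ i \<noteq> 0" by (auto simp: vec_eq_iff)
    then show "0 < (\<Sum>i\<in>UNIV. d i * ((transpose Q *v y) $ i)\<^sup>2)"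
      using d by (intro sum_pos2[where i = i]) (auto simp: less_imp_le)
  qed (simp add: matrix_transpose_mul matrix_mul_assoc)
qed

text \<open>It lets two square roots be compared on one eigenvector of their difference at a time,
  with no simultaneous diagonalization.\<close>

lemma symmetric_matrix_zero:
  fixes D :: "real^'n^'n"
  assumes D: "transpose D = D" and ev: "\<And>e c. e \<noteq> 0 \<Longrightarrow> D *v e = c *\<^sub>R e \<Longrightarrow> c = 0"
  shows "D = 0"
proof -
  obtain Q d where Q: "orthogonal_matrix Q" and eq: "D = Q ** diag_mat d ** transpose Q"
    using symmetric_matrix_diagonalization[OF D] by blast
  have "d i = 0" for i
  proof (rule ev)
    show "Q *v axis i 1 \<noteq> 0"
      by (rule orthogonal_transpose_nonzero(2)[OF Q]) (simp add: axis_eq_0_iff)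
    have "D ** Q = Q ** diag_mat d"
      using Q by (simp only: eq orthogonal_matrix matrix_mul_assoc[symmetric] matrix_mul_rid)
    moreover have "diag_mat d *v axis i 1 = d i *\<^sub>R axis i 1"
      by (simp add: vec_eq_iff diag_mat_vec axis_def)
    ultimately show "D *v (Q *v axis i 1) = d i *\<^sub>R (Q *v axis i 1)"
      by (simp only: matrix_vector_mul_assoc) (simp flip: matrix_vector_mul_assoc add: matrix_vector_mult_scaleR)
  qed
  then have "diag_mat d = 0" by (simp add: diag_mat_def vec_eq_iff)
  then show ?thesis by (simp add: eq)
qed

text \<open>If \<open>X\<^sup>2 = Y\<^sup>2\<close> and \<open>D = X - Y\<close> then \<open>X D = - D Y\<close>, so an eigenvector \<open>e\<close> of \<open>D\<close> with
  eigenvalue \<open>c\<close> satisfies \<open>c (e\<^sup>T X e + e\<^sup>T Y e) = 0\<close>.\<close>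

lemma spd_sqrt_unique:
  fixes X Y :: "real^'n^'n"
  assumes X: "spd X" and Y: "spd Y" and eq: "X ** X = Y ** Y"
  shows "X = Y"
proof -
  have tX: "transpose X = X" and tY: "transpose Y = Y" using X Y by (auto simp: spd_def)
  have tD: "transpose (X - Y) = X - Y"
    using tX tY by (simp add: transpose_def vec_eq_iff)
  have "X - Y = 0"
  proof (rule symmetric_matrix_zero[OF tD])
    fix e c assume e: "e \<noteq> 0" and ev: "(X - Y) *v e = c *\<^sub>R e"
    have XY: "X *v e = Y *v e + c *\<^sub>R e" using ev by (simp add: algebra_simps)
    have "(X *v e) \<bullet> (X *v e) = e \<bullet> ((X ** X) *v e)"
      by (metis inner_transpose_matrix matrix_vector_mul_assoc tX)
    also have "\<dots> = (Y *v e) \<bullet> (Y *v e)"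
      unfolding eq by (metis inner_transpose_matrix matrix_vector_mul_assoc tY)
    finally have "c * (e \<bullet> (X *v e) + e \<bullet> (Y *v e)) = 0"
      unfolding XY by (simp add: algebra_simps inner_commute)
    moreover have "e \<bullet> (X *v e) > 0" "e \<bullet> (Y *v e) > 0" using X Y e by (auto simp: spd_def)
    ultimately show "c = 0" by (simp add: add_pos_pos order_less_imp_not_eq2)
  qed
  then show ?thesis by simp
qed

lemma spd_sqrt_exists:
  fixes A :: "real^'n^'n"
  assumes A: "spd A"
  shows "\<exists>X. spd X \<and> X ** X = A"
proof -
  obtain Q d where Q: "orthogonal_matrix Q" and eq: "A = Q ** diag_mat d ** transpose Q"
    using symmetric_matrix_diagonalization A by (metis spd_def)
  have d: "\<forall>i. d i > 0" using A spd_orthogonal_conj_diag[OF Q] by (simp add: eq)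
  show ?thesis
  proof (intro exI conjI)
    let ?X = "Q ** diag_mat (\<lambda>i. sqrt (d i)) ** transpose Q"
    show "spd ?X" using d by (simp add: spd_orthogonal_conj_diag[OF Q])
    show "?X ** ?X = A"
      using d by (simp add: orthogonal_conj_mult[OF Q] diag_mat_mult eq less_imp_le)
  qed
qed

lemma msqrt:
  fixes A :: "real^'n^'n"
  assumes "spd A"
  shows "spd (msqrt A)" "msqrt A ** msqrt A = A"
proof -
  have "\<exists>!X. spd X \<and> X ** X = A"
    using spd_sqrt_exists[OF assms] spd_sqrt_unique by blast
  from theI'[OF this] show "spd (msqrt A)" "msqrt A ** msqrt A = A"
    by (simp_all add: msqrt_def)
qed

section \<open>The Moore-Penrose inverse\<close>

lemma moore_penrose_unique:
  fixes A :: "real^'n^'m"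
  assumes X: "moore_penrose A X" and Y: "moore_penrose A Y"
  shows "X = Y"
proof -
  \<comment> \<open>\<open>A ** X\<close> and \<open>A ** Y\<close> are symmetric, and each is a
    left identity for the other. Transposing their product swaps the factors, so they coincide;
    likewise \<open>X ** A\<close> and \<open>Y ** A\<close>.\<close>
  have "A ** X = transpose ((A ** Y) ** (A ** X))"
    using X Y unfolding moore_penrose_def by (metis matrix_mul_assoc)
  also have "\<dots> = (A ** X) ** (A ** Y)"
    using X Y by (simp only: moore_penrose_def matrix_transpose_mul[of "A ** Y"])
  also have "\<dots> = A ** Y" using X by (metis moore_penrose_def matrix_mul_assoc)
  finally have AX: "A ** X = A ** Y" .
  have "X ** A = transpose ((X ** A) ** (Y ** A))"
    using X Y unfolding moore_penrose_def by (metis matrix_mul_assoc)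
  also have "\<dots> = (Y ** A) ** (X ** A)"
    using X Y by (simp only: moore_penrose_def matrix_transpose_mul[of "X ** A"])
  also have "\<dots> = Y ** A" using X by (metis moore_penrose_def matrix_mul_assoc)
  finally have XA: "X ** A = Y ** A" .
  have "X = X ** A ** X" using X by (simp add: moore_penrose_def)
  also have "\<dots> = Y ** A ** Y" by (metis AX XA matrix_mul_assoc)
  also have "\<dots> = Y" using Y by (simp add: moore_penrose_def)
  finally show ?thesis .
qed

text \<open>The candidate is \<open>Z ** transpose A\<close>, where \<open>Z\<close> is the
  pseudoinverse of the Gram matrix \<open>transpose A ** A\<close>, read off from its
  diagonalization.\<close>

lemma moore_penrose_exists:
  fixes A :: "real^'n^'m"
  shows "\<exists>X. moore_penrose A X"
proof -
  have tB: "transpose (transpose A ** A) = transpose A ** A"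
    by (simp add: matrix_transpose_mul)
  obtain Q d where Q: "orthogonal_matrix Q" and eq: "transpose A ** A = Q ** diag_mat d ** transpose Q"
    using symmetric_matrix_diagonalization[OF tB] by blast
  \<comment> \<open>The convention \<open>inverse 0 = 0\<close> inverts the nonzero eigenvalues and
    leaves the kernel alone, so a singular Gram matrix is covered too.\<close>
  define Z where "Z = Q ** diag_mat (\<lambda>i. inverse (d i)) ** transpose Q"
  define B where "B = transpose A ** A"
  have tZ: "transpose Z = Z" by (simp add: Z_def matrix_transpose_mul matrix_mul_assoc)
  have ZB: "Z ** B = B ** Z"
    unfolding Z_def B_def eq by (simp add: orthogonal_conj_mult[OF Q] diag_mat_mult mult.commute)
  have ZBZ: "Z ** B ** Z = Z"
    unfolding Z_def B_def eq
    by (simp add: orthogonal_conj_mult[OF Q] diag_mat_mult) 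
      (metis inverse_inverse_eq mult.commute right_inverse mult_zero_left mult_1)
  have BZB: "B ** Z ** B = B"
    unfolding Z_def B_def eq
    by (simp add: orthogonal_conj_mult[OF Q] diag_mat_mult) 
      (metis mult.commute right_inverse mult_zero_left mult_1)
  have AZB: "A ** (Z ** B) = A"
  proof -
    have "A *v ((Z ** B) *v y) = A *v y" for y
    proof -
      \<comment> \<open>\<open>B ** Z ** B = B\<close> puts \<open>w\<close> into the kernel of the
        Gram matrix, and \<open>w . B w = |A w|^2\<close> moves it into the kernel of
        \<open>A\<close>.\<close>
      define w where "w = (Z ** B) *v y - y"
      have "B *v w = (B ** Z ** B - B) *v y"
        by (simp add: w_def algebra_simps matrix_vector_mul_assoc matrix_mul_assoc)
      then have "B *v w = 0" by (simp add: BZB)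
      then have "(A *v w) \<bullet> (A *v w) = 0"
        by (metis B_def inner_commute inner_transpose_matrix inner_zero_left matrix_vector_mul_assoc)
      then have "A *v w = 0" by simp
      then show ?thesis by (simp add: w_def matrix_vector_mult_diff_distrib)
    qed
    then show ?thesis by (simp add: matrix_eq matrix_vector_mul_assoc[symmetric])
  qed
  have "moore_penrose A (Z ** transpose A)"
    unfolding moore_penrose_def
  proof (intro conjI)
    show "A ** (Z ** transpose A) ** A = A"
      using AZB by (simp add: B_def matrix_mul_assoc)
    show "Z ** transpose A ** A ** (Z ** transpose A) = Z ** transpose A"
      using ZBZ by (simp add: B_def matrix_mul_assoc)
    show "transpose (A ** (Z ** transpose A)) = A ** (Z ** transpose A)"
      by (simp add: matrix_transpose_mul tZ matrix_mul_assoc)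
    have "transpose (Z ** B) = B ** Z" by (simp add: matrix_transpose_mul tZ B_def)
    then show "transpose (Z ** transpose A ** A) = Z ** transpose A ** A"
      using ZB by (simp add: B_def matrix_mul_assoc)
  qed
  then show ?thesis by blast
qed

lemma moore_penrose_pinv: "moore_penrose A (pinv A)"
proof -
  have "\<exists>!X. moore_penrose A X"
    using moore_penrose_exists moore_penrose_unique by blast
  from theI'[OF this] show ?thesis by (simp add: pinv_def)
qed

text \<open>\<open>A ** pinv A ** A = A\<close> makes the pseudoinverse injective on the range of
  \<open>A\<close>.\<close>

lemma pinv_mult_eq_0_iff: "pinv A *v (A *v y) = 0 \<longleftrightarrow> A *v y = 0"
proof
  assume "pinv A *v (A *v y) = 0"
  then have "(A ** pinv A ** A) *v y = 0" by (simp flip: matrix_vector_mul_assoc)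
  then show "A *v y = 0" using moore_penrose_pinv[of A] by (simp only: moore_penrose_def)
qed simp

section \<open>Inverses and rank-nullity\<close>

lemma matrix_inv_invertible:
  assumes "invertible A"
  shows "A ** matrix_inv A = mat 1" "matrix_inv A ** A = mat 1"
proof -
  have "A ** matrix_inv A = mat 1 \<and> matrix_inv A ** A = mat 1"
    unfolding matrix_inv_def by (rule someI_ex) (use assms in \<open>simp only: invertible_def\<close>)
  then show "A ** matrix_inv A = mat 1" "matrix_inv A ** A = mat 1" by blast+
qed

lemma matrix_inv_eqI:
  fixes A B :: "'a::semiring_1^'n^'n"
  assumes "A ** B = mat 1" "B ** A = mat 1"
  shows "matrix_inv A = B"
proof -
  have "invertible A" using assms unfolding invertible_def by blast
  note inv = matrix_inv_invertible[OF this]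
  have "matrix_inv A = matrix_inv A ** (A ** B)" by (simp only: assms(1) matrix_mul_rid)
  also have "\<dots> = B" by (simp only: matrix_mul_assoc inv(2) matrix_mul_lid)
  finally show ?thesis .
qed

lemma invertible_spd:
  fixes A :: "real^'n^'n"
  assumes "spd A"
  shows "invertible A"
proof -
  have "\<forall>y. A *v y = 0 \<longrightarrow> y = 0"
    using assms unfolding spd_def by (metis inner_zero_right less_irrefl)
  then show ?thesis by (simp only: invertible_left_inverse matrix_left_invertible_ker)
qed

text \<open>The kernel is the orthogonal complement of the row space, whose dimension is the
  rank.\<close>

lemma rank_nullity:
  fixes A :: "real^'n^'m"
  shows "dim {y. A *v y = 0} + rank A = CARD('n)"
proof -
  have "{y. A *v y = 0} = {y \<in> UNIV. \<forall>r \<in> span (rows A). orthogonal r y}"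
  proof safe
    fix y r assume "A *v y = 0" "r \<in> span (rows A)"
    then show "orthogonal r y"
      by (simp only: orthogonal_commute[of r] orthogonal_nullspace_rowspace)
  next
    fix y assume *: "\<forall>r \<in> span (rows A). orthogonal r y"
    have "(A *v y) $ i = 0" for i
    proof -
      have "row i A \<in> span (rows A)" by (rule span_base) (auto simp: rows_def)
      with * have "row i A \<bullet> y = 0" by (simp add: orthogonal_def)
      then show ?thesis by (simp add: row_def matrix_vector_mult_def inner_vec_def)
    qed
    then show "A *v y = 0" by (simp add: vec_eq_iff)
  qed simp
  then show ?thesis
    using dim_subspace_orthogonal_to_vectors[of "span (rows A)" UNIV]
    by (simp add: row_rank_def)
qed

section \<open>The kernel of the rigidity matrix\<close>

definition ang6 :: "vec6 \<Rightarrow> real^3" where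
  "ang6 w = (\<chi> a. w $ Inr a)"

definition block :: "'n::finite vec6N \<Rightarrow> 'n \<Rightarrow> vec6" where
  "block w k = (\<chi> a. w $ (k, a))"

lemma lin_part_block: "lin_part w k = lin6 (block w k)"
  by (simp add: lin_part_def lin6_def block_def)

lemma ang_part_block: "ang_part w k = ang6 (block w k)"
  by (simp add: ang_part_def ang6_def block_def)

lemma vec6_eqI: "lin6 w = lin6 w' \<Longrightarrow> ang6 w = ang6 w' \<Longrightarrow> w = w'"
  by (auto simp: lin6_def ang6_def vec_eq_iff split_sum_all)

lemma vec6N_eqI:
  assumes "\<And>k. lin_part w k = lin_part w' k" "\<And>k. ang_part w k = ang_part w' k"
  shows "w = w'"
proof -
  have "block w k = block w' k" for k
    using assms by (intro vec6_eqI) (simp_all add: lin_part_block ang_part_block)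
  then show ?thesis by (simp add: block_def vec_eq_iff)
qed

lemma ex_vec6: "\<exists>z. lin6 z = a \<and> ang6 z = b"
  by (rule exI[of _ "\<chi> c. case c of Inl i \<Rightarrow> a $ i | Inr i \<Rightarrow> b $ i"])
    (simp add: lin6_def ang6_def vec_eq_iff)

section \<open>Block matrices acting on stacked vectors\<close>

lemma minus_matrix_vector_mult:
  fixes A :: "'a::ring_1^'n^'m"
  shows "(- A) *v y = - (A *v y)"
  by (simp add: matrix_vector_mult_def vec_eq_iff sum_negf)

lemma skew_mult: "skew a *v b = cross3 a b"
proof -
  have "linear (cross3 a)" by (simp add: linear_iff cross_add_right cross_mult_right)
  then show ?thesis unfolding skew_def by (rule fun_cong[OF matrix_vector_mul(2)])
qed

lemma hcat_mult:
  fixes A B :: "real^3^'r"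
  shows "hcat A B *v w = A *v lin6 w + B *v ang6 w"
  unfolding hcat_def matrix_vector_mult_def lin6_def ang6_def
  by (simp add: vec_eq_iff UNIV_Plus_UNIV[symmetric] sum.Plus del: UNIV_Plus_UNIV)

lemma vcat_mult:
  "(vcat A B *v w) $ Inl a = (A *v w) $ a" "(vcat A B *v w) $ Inr b = (B *v w) $ b"
  by (simp_all add: vcat_def matrix_vector_mult_def)

lemma block_row_mult: "block_row A *v w = (\<Sum>k\<in>UNIV. A k *v block w k)"
proof -
  have "(block_row A *v w) $ r = (\<Sum>k\<in>UNIV. A k *v block w k) $ r" for r
    unfolding block_row_def matrix_vector_mult_def block_def
    by (simp add: UNIV_Times_UNIV[symmetric] sum.cartesian_product case_prod_unfold
        del: UNIV_Times_UNIV)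
  then show ?thesis by (simp add: vec_eq_iff)
qed

lemma block_col_mult: "(block_col A *v w) $ (k, r) = (A k *v w) $ r"
  by (simp add: block_col_def matrix_vector_mult_def)

lemma transpose_block_row: "transpose (block_row A) = block_col (\<lambda>k. transpose (A k))"
  by (simp add: transpose_def block_row_def block_col_def vec_eq_iff)

text \<open>This is the velocity field of a rigid body with angular velocity \<open>ang6 z\<close>
  whose point \<open>q\<close> moves with velocity \<open>lin6 z\<close>; the minus sign reverses
  the usual order of the cross product.\<close>

lemma transpose_grasp_mult:
  "lin_part (transpose (grasp x q) *v z) k = lin6 z - cross3 (pos x k - q) (ang6 z)"
  "ang_part (transpose (grasp x q) *v z) k = ang6 z"
  unfolding lin_part_def ang_part_def grasp_def transpose_block_row transpose_transpose
    block_col_mult grasp_jac_def vcat_mult hcat_mult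
  by (simp_all add: skew_mult minus_matrix_vector_mult vec_eq_iff flip: skew_mult)

lemma two_block_row_mult:
  assumes "i \<noteq> j"
  shows "block_row (\<lambda>k. if k = i then X else if k = j then Y else 0) *v w
       = X *v block w i + Y *v block w j"
proof -
  have "(\<Sum>k\<in>UNIV. (if k = i then X else if k = j then Y else 0) *v block w k)
      = (\<Sum>k\<in>UNIV. (if k = i then X *v block w i else 0) + (if k = j then Y *v block w j else 0))"
    using assms by (intro sum.cong) auto
  then show ?thesis by (simp add: block_row_mult sum.distrib)
qed

lemma distance_row_mult:
  assumes "i \<noteq> j"
  shows "(distance_row x (i, j) *v w) $ r = (pos x j - pos x i) \<bullet> (lin_part w j - lin_part w i)"
  using assms unfolding distance_row_def prod.case two_block_row_mult[OF assms] hcat_mult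
  by (simp add: lin_part_block rowvector_def matrix_vector_mult_def inner_vec_def
      sum.distrib[symmetric] algebra_simps)

lemma proj_perp_mult: "proj_perp y *v u = u - ((y \<bullet> u) / (norm y)\<^sup>2) *\<^sub>R y"
  by (simp add: proj_perp_def vec_eq_iff matrix_vector_mult_diff_rdistrib
      scaleR_matrix_vector_assoc[symmetric])
    (simp add: matrix_vector_mult_def inner_vec_def sum_distrib_left sum_distrib_right mult_ac)

lemma bearing_rows_mult:
  assumes "i \<noteq> j"
  shows "bearing_rows x (i, j) *v w =
      proj_perp (bearing x i j) *v
        ((1 / norm (pos x j - pos x i)) *\<^sub>R (transpose (ori x i) *v (lin_part w j - lin_part w i)))
      + cross3 (bearing x i j) (transpose (ori x i) *v ang_part w i)"
proof -
  have "(- B) *v a + C *v b + B *v c = B *v (c - a) + C *v b" for B C :: "real^3^3" and a b c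
    by (simp add: minus_matrix_vector_mult matrix_vector_mult_diff_distrib)
  note * = this
  show ?thesis
    unfolding bearing_rows_def prod.case Let_def two_block_row_mult[OF assms] hcat_mult *
      matrix_vector_mult_0 add_0_right
    by (simp add: lin_part_block ang_part_block skew_mult matrix_vector_mult_scaleR
        scaleR_matrix_vector_assoc[symmetric] matrix_vector_mul_assoc[symmetric]
        del: transpose_matrix_vector)
qed

lemma rigidity_mult_eq_0_iff:
  fixes x :: "'n::{card2, linorder} config"
  shows "rigidity x *v w = 0 \<longleftrightarrow>
    (\<forall>i j. i < j \<longrightarrow> distance_row x (i, j) *v w = 0) \<and>
    (\<forall>i j. i \<noteq> j \<longrightarrow> bearing_rows x (i, j) *v w = 0)"
proof -
  have "rigidity x *v w = 0 \<longleftrightarrow>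
    (\<forall>e. distance_row x (Rep_uedge e) *v w = 0) \<and> (\<forall>e. bearing_rows x (Rep_edge e) *v w = 0)"
    unfolding rigidity_def
    by (simp add: vec_eq_iff split_sum_all vcat_mult block_col_mult)
  also have "(\<forall>e. distance_row x (Rep_uedge e) *v w = 0) \<longleftrightarrow>
      (\<forall>i j. i < j \<longrightarrow> distance_row x (i, j) *v w = 0)"
  proof (intro iffI allI impI)
    fix i j :: 'n assume *: "\<forall>e. distance_row x (Rep_uedge e) *v w = 0" and "i < j"
    then have "Rep_uedge (Abs_uedge (i, j)) = (i, j)" by (simp add: Abs_uedge_inverse)
    with * show "distance_row x (i, j) *v w = 0" by metis
  next
    fix e :: "'n uedge" assume *: "\<forall>i j. i < j \<longrightarrow> distance_row x (i, j) *v w = 0"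
    obtain i j where "Rep_uedge e = (i, j)" "i < j" using Rep_uedge[of e] by auto
    with * show "distance_row x (Rep_uedge e) *v w = 0" by simp
  qed
  also have "(\<forall>e. bearing_rows x (Rep_edge e) *v w = 0) \<longleftrightarrow>
      (\<forall>i j. i \<noteq> j \<longrightarrow> bearing_rows x (i, j) *v w = 0)"
  proof (intro iffI allI impI)
    fix i j :: 'n assume *: "\<forall>e. bearing_rows x (Rep_edge e) *v w = 0" and "i \<noteq> j"
    then have "Rep_edge (Abs_edge (i, j)) = (i, j)" by (simp add: Abs_edge_inverse)
    with * show "bearing_rows x (i, j) *v w = 0" by metis
  next
    fix e :: "'n edge" assume *: "\<forall>i j. i \<noteq> j \<longrightarrow> bearing_rows x (i, j) *v w = 0"
    obtain i j where "Rep_edge e = (i, j)" "i \<noteq> j" using Rep_edge[of e] by auto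
    with * show "bearing_rows x (Rep_edge e) *v w = 0" by simp
  qed
  finally show ?thesis .
qed

section \<open>Rigid motions lie in the kernel\<close>

lemma rotation_matrix_transpose: "rotation_matrix Q \<Longrightarrow> rotation_matrix (transpose Q)"
  by (simp add: rotation_matrix_def)

lemma rotation_matrix_mult:
  fixes P Q :: "real^'k^'k"
  shows "rotation_matrix P \<Longrightarrow> rotation_matrix Q \<Longrightarrow> rotation_matrix (P ** Q)"
  by (simp add: rotation_matrix_def orthogonal_matrix_mul det_mul)

text \<open>The relative velocity along an edge is the angular velocity crossed with the edge
  vector, hence orthogonal to the edge. Rotations commute with the cross product, so in the body
  frame it becomes \<open>cross3 \<omega> \<gamma>\<close> after scaling; the projector fixes this
  vector and the angular term \<open>cross3 \<gamma> \<omega>\<close> cancels it.\<close>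

lemma rigidity_rigid_motion:
  fixes x :: "'n::{card2, linorder} config"
  assumes x: "x \<in> SE3"
  shows "rigidity x *v (transpose (grasp x q) *v z) = 0"
  unfolding rigidity_mult_eq_0_iff
proof (intro conjI allI impI)
  let ?w = "transpose (grasp x q) *v z"
  have diff: "lin_part ?w j - lin_part ?w i = cross3 (ang6 z) (pos x j - pos x i)" for i j
    by (simp only: transpose_grasp_mult) (simp add: cross3_simps)
  show "distance_row x (i, j) *v ?w = 0" if "i < j" for i j
  proof -
    have "i \<noteq> j" using that by simp
    then have "(distance_row x (i, j) *v ?w) $ r = 0" for r
      by (simp only: distance_row_mult[OF \<open>i \<noteq> j\<close>] diff dot_cross_self)
    then show ?thesis by (simp add: vec_eq_iff)
  qed
  show "bearing_rows x (i, j) *v ?w = 0" if ij: "i \<noteq> j" for i j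
  proof -
    define \<gamma> where "\<gamma> = bearing x i j"
    define \<omega> where "\<omega> = transpose (ori x i) *v ang6 z"
    have "rotation_matrix (transpose (ori x i))"
      using x by (simp add: SE3_def rotation_matrix_transpose)
    then have "transpose (ori x i) *v cross3 (ang6 z) (pos x j - pos x i)
        = cross3 \<omega> (transpose (ori x i) *v (pos x j - pos x i))"
      by (simp only: \<omega>_def cross_rotation_matrix)
    then have "(1 / norm (pos x j - pos x i)) *\<^sub>R
        (transpose (ori x i) *v cross3 (ang6 z) (pos x j - pos x i)) = cross3 \<omega> \<gamma>"
      by (simp only: \<gamma>_def bearing_def norm_minus_commute[of "pos x i"] matrix_vector_mult_scaleR
          cross_mult_right)
    then have "bearing_rows x (i, j) *v ?w = proj_perp \<gamma> *v cross3 \<omega> \<gamma> + cross3 \<gamma> \<omega>"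
      by (simp only: bearing_rows_mult[OF ij] diff transpose_grasp_mult(2) \<gamma>_def \<omega>_def)
    also have "\<dots> = 0"
      by (simp add: proj_perp_mult dot_cross_self cross_skew[of \<gamma>])
    finally show ?thesis .
  qed
qed

text \<open>The distance row removes the component of the relative velocity along the edge. The
  projector in the bearing rows then acts as the identity, and these rows determine the whole
  relative velocity.\<close>

lemma kernel_rigidity_identity_orientation:
  fixes y :: "'n::{card2, linorder} config"
  assumes ori: "\<And>i. ori y i = mat 1" and y: "y \<in> distinct_pos"
    and w: "rigidity y *v w = 0" and ij: "i \<noteq> j"
  shows "lin_part w j - lin_part w i = cross3 (ang_part w i) (pos y j - pos y i)"
proof -
  define n where "n = norm (pos y j - pos y i)"
  define d where "d = pos y j - pos y i"
  have "d \<noteq> 0" using y ij by (auto simp: d_def distinct_pos_def inj_def)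
  then have n: "n > 0" by (simp add: n_def d_def)
  have \<gamma>: "bearing y i j = (1 / n) *\<^sub>R d"
    by (simp add: bearing_def ori n_def d_def norm_minus_commute)
  let ?l = "lin_part w j - lin_part w i"
  have dist: "d \<bullet> ?l = 0"
  proof (cases "i < j")
    case True
    then have "distance_row y (i, j) *v w = 0" using w by (simp add: rigidity_mult_eq_0_iff)
    then have "(distance_row y (i, j) *v w) $ 1 = 0" by simp
    then show ?thesis by (simp only: distance_row_mult[OF ij] d_def)
  next
    case False
    then have "distance_row y (j, i) *v w = 0" using w ij by (simp add: rigidity_mult_eq_0_iff)
    then have "(distance_row y (j, i) *v w) $ 1 = 0" by simp
    then have "(pos y i - pos y j) \<bullet> (lin_part w i - lin_part w j) = 0"
      by (simp only: distance_row_mult[OF ij[symmetric]])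
    then show ?thesis by (simp add: d_def inner_diff_left inner_diff_right)
  qed
  have "0 = bearing_rows y (i, j) *v w" using w ij by (simp add: rigidity_mult_eq_0_iff)
  also have "\<dots> = proj_perp ((1 / n) *\<^sub>R d) *v ((1 / n) *\<^sub>R ?l) + cross3 ((1 / n) *\<^sub>R d) (ang_part w i)"
    by (simp only: bearing_rows_mult[OF ij] \<gamma> ori transpose_mat matrix_vector_mul_lid n_def)
  also have "\<dots> = (1 / n) *\<^sub>R (?l + cross3 d (ang_part w i))"
    using dist by (simp add: proj_perp_mult cross_mult_left scaleR_add_right)
  finally have "?l + cross3 d (ang_part w i) = 0" using n by simp
  then show ?thesis by (simp add: d_def cross_skew[of "ang_part w i"] add_eq_0_iff2)
qed

section \<open>Kernel at a non-collinear configuration\<close>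

lemma cross_diff_left: "cross3 (a - b) c = cross3 a c - cross3 b c"
  and cross_diff_right: "cross3 c (a - b) = cross3 c a - cross3 c b"
  by (simp_all add: cross3_simps)

text \<open>If \<open>a\<close> were nonzero, the double cross product identity would make
  \<open>e\<close> and \<open>f\<close> both multiples of \<open>a\<close>, hence parallel.\<close>

lemma cross_independent_eq_0:
  assumes "cross3 a e = 0" "cross3 a f = 0" "cross3 e f \<noteq> 0"
  shows "a = 0"
proof (rule ccontr)
  assume a: "a \<noteq> 0"
  have "(a \<bullet> a) *\<^sub>R u = (a \<bullet> u) *\<^sub>R a" if "cross3 a u = 0" for u
  proof -
    have "cross3 a (cross3 a u) = (a \<bullet> u) *\<^sub>R a - (a \<bullet> a) *\<^sub>R u"
      by (simp add: cross3_simps forall_3)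
    then show ?thesis by (simp add: that)
  qed
  from this[OF assms(1)] this[OF assms(2)]
  have "cross3 ((a \<bullet> a) *\<^sub>R e) ((a \<bullet> a) *\<^sub>R f) = 0"
    by (simp add: cross_mult_left cross_mult_right)
  then show False using a assms(3) by (simp add: cross_mult_left cross_mult_right)
qed

text \<open>Distinct points of the parabola \<open>(t, t\<^sup>2, 0)\<close> are never collinear in triples.\<close>

lemma noncollinear_config_exists:
  obtains y :: "'n::finite config" where "y \<in> SE3" "y \<in> distinct_pos" "\<And>i. ori y i = mat 1"
    "\<And>i j k. i \<noteq> j \<Longrightarrow> i \<noteq> k \<Longrightarrow> j \<noteq> k \<Longrightarrow> cross3 (pos y j - pos y i) (pos y k - pos y i) \<noteq> 0"
proof -
  obtain f :: "'n \<Rightarrow> nat" where f: "inj f"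
    using finite_imp_inj_to_nat_seg[OF finite[of "UNIV :: 'n set"]] by blast
  define t where "t k = real (f k)" for k
  have t: "t i = t j \<longleftrightarrow> i = j" for i j using f by (simp add: t_def inj_eq)
  define y :: "'n config" where "y = (\<chi> k. (vector [t k, (t k)\<^sup>2, 0], mat 1))"
  have pos: "pos y k = vector [t k, (t k)\<^sup>2, 0]" for k by (simp add: pos_def y_def)
  have ori: "ori y k = mat 1" for k by (simp add: ori_def y_def)
  show thesis
  proof (rule that)
    show "y \<in> SE3" by (simp add: SE3_def ori rotation_matrix_def orthogonal_matrix_id)
    show "y \<in> distinct_pos"
      by (auto simp: distinct_pos_def inj_def pos vec_eq_iff forall_3 vector_3 t)
    show "ori y i = mat 1" for i by (rule ori)
    fix i j k :: 'n assume ijk: "i \<noteq> j" "i \<noteq> k" "j \<noteq> k"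
    \<comment> \<open>The points lie in a plane, so only the third component matters; it is the
      Vandermonde determinant of the three parameters.\<close>
    have "cross3 (pos y j - pos y i) (pos y k - pos y i) $ 3
        = (t j - t i) * (t k - t i) * (t k - t j)"
      by (simp add: cross3_def pos vector_3 power2_eq_square algebra_simps)
    also have "\<dots> \<noteq> 0" using ijk by (simp add: t)
    finally show "cross3 (pos y j - pos y i) (pos y k - pos y i) \<noteq> 0" by auto
  qed
qed

text \<open>In a non-collinear triple the velocity constraints force all angular velocities to agree.\<close>

lemma kernel_rigidity_noncollinear:
  fixes y :: "'n::{card2, linorder} config"
  assumes N: "CARD('n) \<ge> 3" and ori: "\<And>i. ori y i = mat 1" and y: "y \<in> distinct_pos"
    and nc: "\<And>i j k. i \<noteq> j \<Longrightarrow> i \<noteq> k \<Longrightarrow> j \<noteq> k \<Longrightarrow> cross3 (pos y j - pos y i) (pos y k - pos y i) \<noteq> 0"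
    and w: "rigidity y *v w = 0"
  shows "w \<in> range (\<lambda>z. transpose (grasp y 0) *v z)"
proof -
  note vel = kernel_rigidity_identity_orientation[OF ori y w]
  have ang: "ang_part w i = ang_part w j" if ij: "i \<noteq> j" for i j
  proof -
    have "card {i, j} < CARD('n)" using N ij by simp
    then have "{i, j} \<noteq> UNIV" by (metis less_irrefl)
    then obtain k where k: "k \<noteq> i" "k \<noteq> j" by blast
    define e where "e = pos y j - pos y i"
    define f where "f = pos y k - pos y i"
    define a where "a = ang_part w j - ang_part w i"
    \<comment> \<open>The edge between \<open>i\<close> and \<open>j\<close> is read from both ends:
      the same relative velocity is produced by either angular velocity.\<close>
    have "cross3 (ang_part w i) e = - (lin_part w i - lin_part w j)"
      using vel[OF ij] by (simp add: e_def)
    also have "\<dots> = cross3 (ang_part w j) e"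
      using vel[OF ij[symmetric]] cross_minus_right[of "ang_part w j" "pos y i - pos y j"]
      by (simp add: e_def)
    finally have ji: "cross3 a e = 0" by (simp add: a_def cross_diff_left)
    \<comment> \<open>Relative velocities add up around the triangle: \<open>i\<close> to
      \<open>j\<close> plus \<open>j\<close> to \<open>k\<close> equals \<open>i\<close> to
      \<open>k\<close>.\<close>
    have "cross3 (ang_part w i) e + cross3 (ang_part w j) (f - e) = cross3 (ang_part w i) f"
      using vel[of i j] vel[of j k] vel[of i k] k ij by (simp add: e_def f_def algebra_simps)
    then have "cross3 a (f - e) = 0"
      by (simp add: a_def cross_diff_left cross_diff_right algebra_simps)
    then have "cross3 a f = 0" using ji by (simp add: cross_diff_right)
    moreover have "cross3 e f \<noteq> 0" using nc[of i j k] ij k by (simp add: e_def f_def)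
    ultimately have "a = 0" using ji cross_independent_eq_0 by blast
    then show ?thesis by (simp add: a_def)
  qed
  fix i :: 'n
  \<comment> \<open>With reference point 0, the linear part of the twist is the velocity of agent
    \<open>i\<close> extrapolated to the origin.\<close>
  obtain z where z: "ang6 z = ang_part w i" "lin6 z = lin_part w i + cross3 (pos y i) (ang_part w i)"
    using ex_vec6 by blast
  have "w = transpose (grasp y 0) *v z"
  proof (rule vec6N_eqI)
    fix k
    show "ang_part w k = ang_part (transpose (grasp y 0) *v z) k"
      using ang by (cases "k = i") (auto simp only: transpose_grasp_mult z)
    show "lin_part w k = lin_part (transpose (grasp y 0) *v z) k"
    proof (cases "k = i")
      case False
      then have "lin_part w k = lin_part w i + cross3 (ang_part w i) (pos y k - pos y i)"
        using vel[of i k] by (simp add: algebra_simps)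
      then show ?thesis
        by (simp add: transpose_grasp_mult z cross_diff_right cross_skew[of "ang_part w i"]
            del: transpose_matrix_vector)
    qed (simp only: transpose_grasp_mult z, simp)
  qed
  then show ?thesis by blast
qed

text \<open>A dimension squeeze: the kernel at \<open>x\<close> is no larger than the kernel at the
  comparison configuration, which has dimension at most 6. It contains the range of
  \<open>transpose (grasp x q)\<close>, which has dimension exactly 6 because the right inverse
  \<open>H\<close> makes the transpose injective.\<close>

lemma nondegenerate_kernel_rigidity:
  fixes x :: "'n::{card2, linorder} config"
  assumes N: "CARD('n) \<ge> 3" and x: "x \<in> SE3" "nondegenerate x"
    and G: "grasp x q ** H = mat 1"
  shows "{w. rigidity x *v w = 0} = range (\<lambda>z. transpose (grasp x q) *v z)"
proof -
  obtain y :: "'n config" where y: "y \<in> SE3" "y \<in> distinct_pos" "\<And>i. ori y i = mat 1"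
    "\<And>i j k. i \<noteq> j \<Longrightarrow> i \<noteq> k \<Longrightarrow> j \<noteq> k \<Longrightarrow> cross3 (pos y j - pos y i) (pos y k - pos y i) \<noteq> 0"
    using noncollinear_config_exists by blast
  let ?ranks = "(\<lambda>y. rank (rigidity y)) ` (SE3 \<inter> distinct_pos :: 'n config set)"
  \<comment> \<open>\<open>Max\<close> is informative only on finite sets. There are infinitely many
    configurations, but the column count bounds their ranks.\<close>
  have "?ranks \<subseteq> {..CARD('n \<times> (3 + 3))}"
    using rank_bound[of "rigidity _ :: real^('n \<times> (3 + 3))^_"] by (auto simp del: card_prod card_sum)
  then have "finite ?ranks" using finite_subset by blast
  then have "rank (rigidity y) \<le> rank (rigidity x)"
    using x(2) y(1,2) unfolding nondegenerate_def by (auto intro!: Max_ge)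
  then have "dim {w. rigidity x *v w = 0} \<le> dim {w. rigidity y *v w = 0}"
    using rank_nullity[of "rigidity x"] rank_nullity[of "rigidity y"] by linarith
  also have "\<dots> \<le> dim (range (\<lambda>z. transpose (grasp y 0) *v z))"
    using kernel_rigidity_noncollinear[OF N y(3,2,4)] by (intro dim_subset) blast
  also have "\<dots> \<le> CARD(3 + 3)"
    unfolding rank_dim_range[symmetric] using rank_bound[of "transpose (grasp y 0)"] by simp
  also have "CARD(3 + 3) = rank (transpose (grasp x q))"
  proof -
    have "transpose H ** transpose (grasp x q) = mat 1"
      by (metis G matrix_transpose_mul transpose_mat)
    then have "inj ((*v) (transpose (grasp x q)))" using matrix_left_invertible_injective by blast
    then have "rank (transpose (grasp x q)) = CARD(3 + 3)" by (simp only: full_rank_injective)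
    then show ?thesis by (rule sym)
  qed
  also have "\<dots> = dim (range (\<lambda>z. transpose (grasp x q) *v z))" by (rule rank_dim_range)
  finally have "dim {w. rigidity x *v w = 0} \<le> dim (range (\<lambda>z. transpose (grasp x q) *v z))" .
  moreover have "range (\<lambda>z. transpose (grasp x q) *v z) \<subseteq> {w. rigidity x *v w = 0}"
    using rigidity_rigid_motion[OF x(1)] by blast
  moreover have "subspace (range (\<lambda>z. transpose (grasp x q) *v z))"
    by (intro linear_subspace_image matrix_vector_mul_linear subspace_UNIV)
  moreover have "subspace {w. rigidity x *v w = 0}"
    by (rule subspaceI) (auto simp: matrix_vector_right_distrib matrix_vector_mult_scaleR)
  ultimately show ?thesis using subspace_dim_equal by metis
qed

section \<open>Differentiation along a rigid motion\<close>

text \<open>The entries may lie in any Euclidean space, so applying this twice reduces matrices to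
  scalar entries.\<close>

lemma differentiable_vec_nth_iff:
  fixes f :: "'a::euclidean_space \<Rightarrow> 'b::euclidean_space^'n"
  shows "f differentiable (at a) \<longleftrightarrow> (\<forall>i. (\<lambda>x. f x $ i) differentiable (at a))"
proof
  assume f: "f differentiable (at a)"
  show "\<forall>i. (\<lambda>x. f x $ i) differentiable (at a)"
  proof
    fix i
    have "(\<lambda>y :: 'b^'n. y $ i) differentiable (at (f a))"
      by (intro bounded_linear_imp_differentiable bounded_linear_vec_nth)
    from differentiable_chain_at[OF f this] show "(\<lambda>x. f x $ i) differentiable (at a)"
      by (simp add: o_def)
  qed
next
  assume *: "\<forall>i. (\<lambda>x. f x $ i) differentiable (at a)"
  have "(\<lambda>x. f x \<bullet> axis i b) differentiable (at a)" if "b \<in> Basis" for i b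
  proof -
    have "(\<lambda>x. f x $ i \<bullet> b) differentiable (at a)"
      using * that differentiable_componentwise_within[of "\<lambda>x. f x $ i" a UNIV] by blast
    then show ?thesis by (simp add: inner_axis)
  qed
  then have "\<forall>e \<in> Basis. (\<lambda>x. f x \<bullet> e) differentiable (at a)"
    unfolding Basis_vec_def by blast
  then show "f differentiable (at a)"
    by (simp only: differentiable_componentwise_within[of f a UNIV])
qed

lemma differentiable_matrix_iff:
  fixes A :: "'a::euclidean_space \<Rightarrow> real^'n^'m"
  shows "A differentiable (at a) \<longleftrightarrow> (\<forall>i j. (\<lambda>x. A x $ i $ j) differentiable (at a))"
  by (simp add: differentiable_vec_nth_iff)

lemma has_derivative_vecI:
  fixes f :: "'a::euclidean_space \<Rightarrow> 'b::euclidean_space^'n"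
  assumes "\<And>i. ((\<lambda>x. f x $ i) has_derivative (\<lambda>h. f' h $ i)) (at a)"
  shows "(f has_derivative f') (at a)"
proof -
  have "((\<lambda>x. f x \<bullet> axis i b) has_derivative (\<lambda>h. f' h \<bullet> axis i b)) (at a)" for i b
    using has_derivative_inner_left[OF assms[of i], of b] by (simp add: inner_axis)
  then have "\<forall>e \<in> Basis. ((\<lambda>x. f x \<bullet> e) has_derivative (\<lambda>h. f' h \<bullet> e)) (at a)"
    unfolding Basis_vec_def by blast
  then show ?thesis
    by (simp only: has_derivative_componentwise_within[of f f' a UNIV])
qed

lemma differentiable_if:
  assumes "f differentiable F" "g differentiable F"
  shows "(\<lambda>x. if P then f x else g x) differentiable F"
  by (cases P) (simp_all add: assms)

lemma differentiable_pos: "(\<lambda>x. pos x i) differentiable (at a)"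
  unfolding pos_def
  by (intro bounded_linear_imp_differentiable bounded_linear_compose[OF bounded_linear_fst]
      bounded_linear_vec_nth)

lemma differentiable_ori: "(\<lambda>x. ori x i) differentiable (at a)"
  unfolding ori_def
  by (intro bounded_linear_imp_differentiable bounded_linear_compose[OF bounded_linear_snd]
      bounded_linear_vec_nth)

lemma differentiable_norm:
  fixes f :: "'a::euclidean_space \<Rightarrow> 'b::euclidean_space"
  assumes "f differentiable (at a)" "f a \<noteq> 0"
  shows "(\<lambda>x. norm (f x)) differentiable (at a)"
  using differentiable_chain_at[OF assms(1) differentiable_norm_at] assms(2) by (simp add: o_def)

lemma differentiable_vcat:
  assumes "A differentiable (at a)" "B differentiable (at a)"
  shows "(\<lambda>x. vcat (A x) (B x)) differentiable (at (a :: 'a::euclidean_space))"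
  using assms unfolding differentiable_matrix_iff
  by (auto simp: vcat_def split_sum_all)

lemma differentiable_hcat:
  assumes "A differentiable (at a)" "B differentiable (at a)"
  shows "(\<lambda>x. hcat (A x) (B x)) differentiable (at (a :: 'a::euclidean_space))"
  using assms unfolding differentiable_matrix_iff
  by (auto simp: hcat_def split_sum_all)

lemma differentiable_block_row:
  assumes "\<And>k. (\<lambda>x. A x k) differentiable (at a)"
  shows "(\<lambda>x. block_row (A x)) differentiable (at (a :: 'a::euclidean_space))"
  using assms unfolding differentiable_matrix_iff by (auto simp: block_row_def)

lemma differentiable_block_col:
  assumes "\<And>k. (\<lambda>x. A x k) differentiable (at a)"
  shows "(\<lambda>x. block_col (A x)) differentiable (at (a :: 'a::euclidean_space))"
  using assms unfolding differentiable_matrix_iff by (auto simp: block_col_def)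

lemma differentiable_transpose:
  fixes A :: "'a::euclidean_space \<Rightarrow> real^'n^'m"
  assumes "A differentiable (at a)"
  shows "(\<lambda>x. transpose (A x)) differentiable (at a)"
  using assms unfolding differentiable_matrix_iff by (simp add: transpose_def)

lemma differentiable_matrix_mult:
  fixes A :: "'a::euclidean_space \<Rightarrow> real^'n^'m" and B :: "'a \<Rightarrow> real^'k^'n"
  assumes "A differentiable (at a)" "B differentiable (at a)"
  shows "(\<lambda>x. A x ** B x) differentiable (at a)"
  using assms unfolding differentiable_matrix_iff
  by (auto simp: matrix_matrix_mult_def)

lemma differentiable_matrix_vector_mult:
  fixes A :: "'a::euclidean_space \<Rightarrow> real^'n^'m" and y :: "'a \<Rightarrow> real^'n"
  assumes "A differentiable (at a)" "y differentiable (at a)"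
  shows "(\<lambda>x. A x *v y x) differentiable (at a)"
  using assms unfolding differentiable_matrix_iff differentiable_vec_nth_iff[of y]
    differentiable_vec_nth_iff[of "\<lambda>x. A x *v y x"]
  by (auto simp: matrix_vector_mult_def)

lemma skew_nth: "skew a $ i $ j = cross3 a (axis j 1) $ i"
  unfolding skew_mult[symmetric] by (simp add: matrix_vector_mul_component inner_axis)

lemma differentiable_skew:
  fixes y :: "'a::euclidean_space \<Rightarrow> real^3"
  assumes "y differentiable (at a)"
  shows "(\<lambda>x. skew (y x)) differentiable (at a)"
  using assms unfolding differentiable_matrix_iff differentiable_vec_nth_iff[of y] skew_nth
  by (auto simp: forall_3 cross_components)

lemma differentiable_rowvector:
  fixes y :: "'a::euclidean_space \<Rightarrow> real^'n"
  assumes "y differentiable (at a)"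
  shows "(\<lambda>x. rowvector (y x) :: real^'n^1) differentiable (at a)"
  using assms unfolding differentiable_matrix_iff differentiable_vec_nth_iff[of y]
  by (auto simp: rowvector_def)

lemma differentiable_proj_perp:
  fixes y :: "'a::euclidean_space \<Rightarrow> real^'n"
  assumes "y differentiable (at a)" "y a \<noteq> 0"
  shows "(\<lambda>x. proj_perp (y x)) differentiable (at a)"
  using assms differentiable_norm[OF assms]
  unfolding differentiable_matrix_iff differentiable_vec_nth_iff[of y] proj_perp_def
  by (auto simp: mat_def)

section \<open>Differentiability of the rigidity and grasp matrices\<close>

lemma differentiable_bearing:
  assumes "pos x i \<noteq> pos x j"
  shows "(\<lambda>y. bearing y i j) differentiable (at x)"
  unfolding bearing_def using assms
  by (intro differentiable_matrix_vector_mult differentiable_transpose differentiable_ori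
      derivative_intros differentiable_pos differentiable_norm) auto

text \<open>The projector divides by the squared norm of the bearing, so its differentiability rests
  on this.\<close>

lemma bearing_nonzero:
  assumes x: "x \<in> SE3" and "pos x i \<noteq> pos x j"
  shows "bearing x i j \<noteq> 0"
proof -
  have "orthogonal_matrix (ori x i)" using x by (simp add: SE3_def rotation_matrix_def)
  then show ?thesis
    unfolding bearing_def by (rule orthogonal_transpose_nonzero(1)) (use assms in auto)
qed

lemma differentiable_rigidity:
  fixes x :: "'n::{card2, linorder} config"
  assumes x: "x \<in> SE3" "x \<in> distinct_pos"
  shows "rigidity differentiable (at x)"
proof -
  have ne: "pos x i \<noteq> pos x j" if "i \<noteq> j" for i j
    using x(2) that by (auto simp: distinct_pos_def inj_def)
  have "(\<lambda>y. distance_row y (i, j)) differentiable (at x)" for i j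
    unfolding distance_row_def prod.case
    by (intro differentiable_block_row differentiable_if differentiable_hcat differentiable_rowvector
        differentiable_diff differentiable_pos differentiable_const)
  then have "(\<lambda>y. distance_row y e) differentiable (at x)" for e by (cases e) simp
  moreover have bearing: "(\<lambda>y. bearing_rows y (i, j)) differentiable (at x)" if ij: "i \<noteq> j" for i j
  proof -
    have *: "(\<lambda>y. (1 / norm (pos y j - pos y i)) *\<^sub>R (proj_perp (bearing y i j) ** transpose (ori y i)))
        differentiable (at x)"
      using ne[OF ij] bearing_nonzero[OF x(1) ne[OF ij]]
      by (intro differentiable_scaleR differentiable_divide differentiable_norm differentiable_diff
          differentiable_matrix_mult differentiable_proj_perp differentiable_bearing
          differentiable_transpose differentiable_ori differentiable_pos differentiable_const) auto
    have "(\<lambda>y. skew (bearing y i j) ** transpose (ori y i)) differentiable (at x)"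
      using ne[OF ij] by (intro differentiable_matrix_mult differentiable_skew differentiable_bearing
          differentiable_transpose differentiable_ori)
    with * show ?thesis unfolding bearing_rows_def prod.case Let_def
      by (intro differentiable_block_row differentiable_if differentiable_hcat differentiable_minus
          differentiable_const)
  qed
  have "(\<lambda>y. bearing_rows y (Rep_edge e)) differentiable (at x)" for e
    using bearing Rep_edge[of e] by (cases "Rep_edge e") auto
  ultimately show ?thesis
    unfolding rigidity_def by (intro differentiable_vcat differentiable_block_col)
qed

lemma differentiable_grasp:
  fixes x :: "'n::finite config"
  shows "(\<lambda>(y, q). grasp y q) differentiable (at (x, pO))"
proof -
  have "bounded_linear (\<lambda>p :: 'n config \<times> (real^3). fst (fst p $ i))" for i
    by (rule bounded_linear_compose[OF bounded_linear_fst
          bounded_linear_compose[OF bounded_linear_vec_nth bounded_linear_fst]])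
  then have "(\<lambda>p :: 'n config \<times> (real^3). pos (fst p) i - snd p) differentiable (at (x, pO))" for i
    unfolding pos_def
    by (intro differentiable_diff bounded_linear_imp_differentiable bounded_linear_snd)
  then show ?thesis unfolding case_prod_unfold grasp_def grasp_jac_def
    by (intro differentiable_block_row differentiable_transpose differentiable_vcat
        differentiable_hcat differentiable_minus differentiable_skew differentiable_const)
qed

text \<open>By the Cayley parametrisation a rotation about \<open>\<omega>\<close> has the form \<open>I + a S + b S\<^sup>2\<close> with
  \<open>S = S(\<omega>)\<close>; orthogonality amounts to the relation between \<open>a\<close> and \<open>b\<close> below.\<close>

lemma rotation_matrix_skew_quadratic:
  assumes "2 * b = a\<^sup>2 + (norm w)\<^sup>2 * b\<^sup>2"
  shows "rotation_matrix (mat 1 + a *\<^sub>R skew w + b *\<^sub>R (skew w ** skew w))"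
proof -
  define Q where "Q = mat 1 + a *\<^sub>R skew w + b *\<^sub>R (skew w ** skew w)"
  \<comment> \<open>The common defect of both conditions. With \<open>S = skew w\<close> one has
    \<open>S^4 = - |w|^2 S^2\<close>, so \<open>Q^T Q = I + m S^2\<close>; the eigenvalues
    \<open>1\<close> and \<open>1 - b |w|^2 \<plusminus> i a |w|\<close> give determinant
    \<open>1 - |w|^2 m\<close>.\<close>
  define m where "m = 2 * b - a\<^sup>2 - (norm w)\<^sup>2 * b\<^sup>2"
  have m0: "m = 0" using assms by (simp add: m_def)
  have m: "m = 2 * b - a\<^sup>2 - ((w $ 1)\<^sup>2 + (w $ 2)\<^sup>2 + (w $ 3)\<^sup>2) * b\<^sup>2"
    unfolding m_def power2_norm_eq_inner by (simp add: inner_vec_def sum_3 power2_eq_square)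
  note entries = Q_def matrix_matrix_mult_def skew_nth cross_components mat_def sum_3 axis_def
  have "transpose Q ** Q = mat 1 + m *\<^sub>R (skew w ** skew w)"
    unfolding m
    by (simp add: vec_eq_iff forall_3 entries transpose_def power2_eq_square algebra_simps)
  moreover have "det Q = 1 - ((w $ 1)\<^sup>2 + (w $ 2)\<^sup>2 + (w $ 3)\<^sup>2) * m"
    unfolding m by (simp add: det_3 entries power2_eq_square algebra_simps)
  ultimately show ?thesis
    using m0 by (simp add: rotation_matrix_def orthogonal_matrix flip: Q_def)
qed

lemma bounded_bilinear_matrix_vector_mult:
  "bounded_bilinear ((*v) :: real^'n^'m \<Rightarrow> real^'n \<Rightarrow> real^'m)"
  unfolding bilinear_conv_bounded_bilinear[symmetric] bilinear_def linear_iff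
  by (simp add: matrix_vector_right_distrib matrix_vector_mult_scaleR matrix_vector_mult_add_rdistrib
      scaleR_matrix_vector_assoc)

text \<open>The identity \<open>\<R> G\<^sup>T = 0\<close> fails off \<open>SE(3)\<close>, so it must be differentiated along a curve that
  stays inside. The Cayley transform of \<open>t S / 2\<close> gives \<open>a(t) = t / (1 + \<theta>\<^sup>2 t\<^sup>2 / 4)\<close> and
  \<open>b(t) = t a(t) / 2\<close> with \<open>\<theta> = |\<omega>|\<close>.\<close>

lemma rigid_motion_curve:
  fixes x :: "'n::finite config"
  assumes x: "x \<in> SE3" and \<omega>: "\<And>k. ang_part v k = \<omega>"
  obtains c :: "real \<Rightarrow> 'n config" where "c 0 = x" "\<And>t. c t \<in> SE3"
    "(c has_derivative (\<lambda>t. t *\<^sub>R config_rate x v)) (at 0)"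
proof -
  define D where "D t = 1 + (norm \<omega>)\<^sup>2 * t\<^sup>2 / 4" for t :: real
  define a where "a t = t / D t" for t
  define b where "b t = t\<^sup>2 / 2 / D t" for t
  have D: "D t > 0" for t unfolding D_def by (intro add_pos_nonneg) auto
  have dD: "(D has_derivative (\<lambda>h. 0)) (at 0)"
    unfolding D_def by (auto intro!: derivative_eq_intros)
  have D0: "D 0 = 1" by (simp add: D_def)
  have da: "(a has_derivative (\<lambda>h. h)) (at 0)"
    unfolding a_def by (rule derivative_eq_intros dD | use D0 in force)+
  have db: "(b has_derivative (\<lambda>h. 0)) (at 0)"
    unfolding b_def by (rule derivative_eq_intros dD | use D0 in force)+
  have ab: "2 * b t = (a t)\<^sup>2 + (norm \<omega>)\<^sup>2 * (b t)\<^sup>2" for t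
  proof -
    have "2 * b t = t\<^sup>2 * D t / (D t)\<^sup>2"
      using D[of t] by (simp add: b_def power2_eq_square)
    also have "\<dots> = (a t)\<^sup>2 + (norm \<omega>)\<^sup>2 * (b t)\<^sup>2"
      unfolding a_def b_def power_divide by (simp add: D_def add_divide_distrib[symmetric] algebra_simps)
        (simp add: power2_eq_square add_divide_distrib)
    finally show ?thesis .
  qed
  define S where "S = skew \<omega>"
  \<comment> \<open>Only the orientations are constrained, so the positions may follow straight
    lines: the curve has to match the motion to first order at 0, not to be rigid.\<close>
  define c :: "real \<Rightarrow> 'n config" where
    "c t = (\<chi> k. (pos x k + t *\<^sub>R lin_part v k,
                  ori x k + a t *\<^sub>R (S ** ori x k) + b t *\<^sub>R (S ** S ** ori x k)))" for t
  have "ori (c t) k = (mat 1 + a t *\<^sub>R S + b t *\<^sub>R (S ** S)) ** ori x k" for t k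
    by (simp add: ori_def c_def matrix_eq matrix_vector_mul_assoc[symmetric]
        matrix_vector_mult_add_rdistrib scaleR_matrix_vector_assoc[symmetric])
  then have "c t \<in> SE3" for t
    using x rotation_matrix_skew_quadratic[OF ab]
    by (simp add: SE3_def S_def rotation_matrix_mult)
  moreover have "c 0 = x"
    by (simp add: c_def a_def b_def pos_def ori_def)
  moreover have "(c has_derivative (\<lambda>t. t *\<^sub>R config_rate x v)) (at 0)"
  proof (rule has_derivative_vecI)
    fix k
    have "((\<lambda>t. ori x k + a t *\<^sub>R (S ** ori x k) + b t *\<^sub>R (S ** S ** ori x k)) has_derivative
        (\<lambda>t. t *\<^sub>R (S ** ori x k))) (at 0)"
      by (auto intro!: derivative_eq_intros da db)
    moreover have "((\<lambda>t. pos x k + t *\<^sub>R lin_part v k) has_derivative (\<lambda>t. t *\<^sub>R lin_part v k)) (at 0)"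
      by (auto intro!: derivative_eq_intros)
    ultimately show "((\<lambda>t. c t $ k) has_derivative (\<lambda>t. (t *\<^sub>R config_rate x v) $ k)) (at 0)"
      by (simp add: c_def config_rate_def \<omega> S_def has_derivative_Pair)
  qed
  ultimately show thesis using that by blast
qed

text \<open>Along a curve in SE(3) with the given velocity, the product of the rigidity matrix with
  \<open>transpose G *v vO\<close> is identically zero when \<open>vO\<close> is held fixed. The
  product rule at time 0 gives the two terms.\<close>

lemma rigidity_dot_rigid_motion:
  fixes x :: "'n::{card2, linorder} config"
  assumes x: "x \<in> SE3" "x \<in> distinct_pos" and v: "v = transpose (grasp x pO) *v vO"
  shows "rigidity_dot x v *v v + rigidity x *v (transpose (grasp_dot x pO v vO) *v vO) = 0"
proof -
  have "ang_part v k = ang6 vO" for k unfolding v by (rule transpose_grasp_mult)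
  from rigid_motion_curve[OF x(1) this] obtain c :: "real \<Rightarrow> 'n config"
    where c0: "c 0 = x" and c: "\<And>t. c t \<in> SE3"
      and dc: "(c has_derivative (\<lambda>t. t *\<^sub>R config_rate x v)) (at 0)" by blast
  define q where "q t = pO + t *\<^sub>R lin6 vO" for t :: real
  have dq: "(q has_derivative (\<lambda>t. t *\<^sub>R lin6 vO)) (at 0)"
    unfolding q_def by (auto intro!: derivative_eq_intros)
  have dR: "((\<lambda>t. rigidity (c t)) has_derivative
      (\<lambda>t. frechet_derivative rigidity (at x) (t *\<^sub>R config_rate x v))) (at 0)"
    using diff_chain_at[OF dc, of rigidity] differentiable_rigidity[OF x]
    by (simp add: c0 frechet_derivative_works o_def)
  have "((\<lambda>t. (c t, q t)) has_derivative (\<lambda>t. (t *\<^sub>R config_rate x v, t *\<^sub>R lin6 vO))) (at 0)"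
    by (rule has_derivative_Pair[OF dc dq])
  from diff_chain_at[OF this, of "\<lambda>(y, q). grasp y q"] differentiable_grasp[of x pO]
  have dG: "((\<lambda>t. grasp (c t) (q t)) has_derivative
      (\<lambda>t. frechet_derivative (\<lambda>(y, q). grasp y q) (at (x, pO))
        (t *\<^sub>R config_rate x v, t *\<^sub>R lin6 vO))) (at 0)"
    by (simp add: c0 q_def frechet_derivative_works o_def)
  have "linear (\<lambda>A :: real^('n \<times> (3 + 3))^(3 + 3). transpose A *v vO)"
    by (auto simp: linear_iff transpose_def matrix_vector_mult_def vec_eq_iff sum.distrib
        sum_distrib_left algebra_simps simp del: transpose_matrix_vector)
  then have "bounded_linear (\<lambda>A :: real^('n \<times> (3 + 3))^(3 + 3). transpose A *v vO)"
    by (simp only: linear_conv_bounded_linear)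
  from bounded_linear.has_derivative[OF this dG]
  have dGv: "((\<lambda>t. transpose (grasp (c t) (q t)) *v vO) has_derivative
      (\<lambda>t. transpose (frechet_derivative (\<lambda>(y, q). grasp y q) (at (x, pO))
        (t *\<^sub>R config_rate x v, t *\<^sub>R lin6 vO)) *v vO)) (at 0)" .
  from bounded_bilinear.FDERIV[OF bounded_bilinear_matrix_vector_mult dR dGv]
  have "((\<lambda>t. 0 :: real^('n uedge \<times> 1 + 'n edge \<times> 3)) has_derivative
      (\<lambda>t. rigidity x *v (transpose (frechet_derivative (\<lambda>(y, q). grasp y q) (at (x, pO))
          (t *\<^sub>R config_rate x v, t *\<^sub>R lin6 vO)) *v vO)
        + frechet_derivative rigidity (at x) (t *\<^sub>R config_rate x v) *v v)) (at 0)"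
    by (simp only: rigidity_rigid_motion[OF c] c0 q_def scaleR_zero_left add_0_right v[symmetric])
  \<comment> \<open>The derivative of the constant zero function vanishes; evaluating it at the
    increment 1 recovers the directional derivatives in \<open>rigidity_dot\<close> and
    \<open>grasp_dot\<close>.\<close>
  from has_derivative_unique[OF this has_derivative_const]
  have "rigidity x *v (transpose (frechet_derivative (\<lambda>(y, q). grasp y q) (at (x, pO))
          (1 *\<^sub>R config_rate x v, 1 *\<^sub>R lin6 vO)) *v vO)
        + frechet_derivative rigidity (at x) (1 *\<^sub>R config_rate x v) *v v = 0"
    by meson
  then show ?thesis
    by (simp only: rigidity_dot_def grasp_dot_def scaleR_one add.commute)
qed

section \<open>Internal forces\<close>

lemma internal_force_eq_0_iff:
  fixes M :: "'n::{card2, linorder} mat6N"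
  assumes M: "spd M"
  shows "internal_force M C g x v u = 0 \<longleftrightarrow>
    pinv (rigidity x ** matrix_inv (msqrt M)) *v
      (rigidity_dot x v *v v + rigidity x *v (matrix_inv M *v (u - C *v v - g))) = 0"
proof -
  have "msqrt M *v y = 0 \<longleftrightarrow> y = 0" for y
    using msqrt(1)[OF M] unfolding spd_def
    by (metis inner_zero_right less_irrefl matrix_vector_mult_0_right)
  then show ?thesis by (simp add: internal_force_def Let_def)
qed

lemma matrix_inv_spd:
  fixes M :: "real^'n^'n"
  assumes M: "spd M"
  shows "matrix_inv M = matrix_inv (msqrt M) ** matrix_inv (msqrt M)"
proof (rule matrix_inv_eqI)
  note inv = matrix_inv_invertible[OF invertible_spd[OF msqrt(1)[OF M]]]
  let ?S = "msqrt M" and ?T = "matrix_inv (msqrt M)"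
  have "M ** (?T ** ?T) = ?S ** (?S ** ?T) ** ?T"
    by (simp only: msqrt(2)[OF M] matrix_mul_assoc)
  then show "M ** (?T ** ?T) = mat 1" by (simp only: inv matrix_mul_rid)
  have "(?T ** ?T) ** M = ?T ** (?T ** ?S) ** ?S"
    by (simp only: msqrt(2)[OF M] matrix_mul_assoc[symmetric])
  then show "(?T ** ?T) ** M = mat 1" by (simp only: inv matrix_mul_rid)
qed

text \<open>In the acceleration, the part from \<open>dvO\<close> is a rigid motion and is
  annihilated, while the part from \<open>grasp_dot\<close> cancels the \<open>rigidity_dot\<close>
  term; only the forces survive.\<close>

lemma internal_force_grasp_dynamics:
  fixes x :: "'n::{card2, linorder} config"
  assumes x: "x \<in> SE3" "x \<in> distinct_pos" and M: "spd M"
    and v: "v = transpose (grasp x pO) *v vO"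
    and dyn: "grasp_dynamics M C g MO CO gO (grasp x pO) (grasp_dot x pO v vO) v vO dv dvO u h"
  shows "internal_force M C g x v u = 0 \<longleftrightarrow> rigidity x *v (matrix_inv M *v h) = 0"
proof -
  let ?T = "matrix_inv (msqrt M)"
  have "M *v dv + C *v v + g = u - h" using dyn unfolding grasp_dynamics_def by blast
  then have "u - C *v v - g = M *v dv + h" by (simp add: algebra_simps)
  then have "matrix_inv M *v (u - C *v v - g) = dv + matrix_inv M *v h"
    by (simp only: matrix_vector_right_distrib matrix_vector_mul_assoc matrix_vector_mul_lid
        matrix_inv_invertible(2)[OF invertible_spd[OF M]])
  moreover have "rigidity_dot x v *v v + rigidity x *v dv = 0"
  proof -
    have "dv = transpose (grasp x pO) *v dvO + transpose (grasp_dot x pO v vO) *v vO"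
      using dyn unfolding grasp_dynamics_def by blast
    then have "rigidity x *v dv = rigidity x *v (transpose (grasp_dot x pO v vO) *v vO)"
      by (simp only: matrix_vector_right_distrib rigidity_rigid_motion[OF x(1)] add_0_left)
    then show ?thesis using rigidity_dot_rigid_motion[OF x v] by simp
  qed
  ultimately have "rigidity_dot x v *v v + rigidity x *v (matrix_inv M *v (u - C *v v - g))
      = rigidity x *v (matrix_inv M *v h)"
    by (simp add: matrix_vector_right_distrib add.assoc[symmetric])
  \<comment> \<open>Splitting the inverse inertia into two equal factors exhibits the argument of
    the pseudoinverse as an element of the range of \<open>rigidity x ** ?T\<close>.\<close>
  also have "\<dots> = (rigidity x ** ?T) *v (?T *v h)"
    by (simp only: matrix_inv_spd[OF M] matrix_vector_mul_assoc matrix_mul_assoc)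
  finally have eq: "rigidity_dot x v *v v + rigidity x *v (matrix_inv M *v (u - C *v v - g))
      = (rigidity x ** ?T) *v (?T *v h)" .
  show ?thesis
    unfolding internal_force_eq_0_iff[OF M] eq pinv_mult_eq_0_iff
    by (simp only: matrix_inv_spd[OF M] matrix_vector_mul_assoc matrix_mul_assoc)
qed

text \<open>Without a solution for each prescribed \<open>h\<close>, a claim about all solutions
  could hold vacuously. The object equation fixes \<open>dvO\<close>, rigidity then fixes
  \<open>dv\<close>, and the input absorbs the rest.\<close>

lemma grasp_dynamics_solvable:
  assumes MO: "spd MO"
  shows "\<exists>dv dvO u. grasp_dynamics M C g MO CO gO G dG v vO dv dvO u h"
proof -
  define dvO where "dvO = matrix_inv MO *v (G *v h - CO *v vO - gO)"
  have "MO *v dvO = G *v h - CO *v vO - gO"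
    by (simp only: dvO_def matrix_vector_mul_assoc matrix_inv_invertible(1)[OF invertible_spd[OF MO]]
        matrix_vector_mul_lid)
  then show ?thesis
    unfolding grasp_dynamics_def
    by (intro exI[of _ "transpose G *v dvO + transpose dG *v vO"] exI[of _ dvO]
        exI[of _ "M *v (transpose G *v dvO + transpose dG *v vO) + C *v v + g + h"]) simp
qed

text \<open>The right inverse gives \<open>transpose H ** transpose G = mat 1\<close>, so
  \<open>transpose G\<close> sends nonzero vectors to nonzero vectors.\<close>

lemma spd_congruence:
  fixes G :: "real^'n^'m"
  assumes M: "spd M" and GH: "G ** H = mat 1"
  shows "spd (G ** M ** transpose G)"
  unfolding spd_def
proof (intro conjI allI impI)
  show "transpose (G ** M ** transpose G) = G ** M ** transpose G"
    using M by (simp add: spd_def matrix_transpose_mul matrix_mul_assoc)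
  fix y :: "real^'m" assume "y \<noteq> 0"
  have "transpose H *v (transpose G *v y) = y"
    by (metis GH matrix_transpose_mul matrix_vector_mul_assoc matrix_vector_mul_lid transpose_mat)
  with \<open>y \<noteq> 0\<close> have "transpose G *v y \<noteq> 0" by (metis matrix_vector_mult_0_right)
  then have "0 < (transpose G *v y) \<bullet> (M *v (transpose G *v y))"
    using M unfolding spd_def by blast
  also have "\<dots> = y \<bullet> ((G ** M ** transpose G) *v y)"
    by (simp only: inner_transpose_matrix[of y G, symmetric] matrix_vector_mul_assoc[symmetric])
  finally show "0 < y \<bullet> ((G ** M ** transpose G) *v y)" .
qed

text \<open>A priori the preimage \<open>z\<close> may depend on \<open>y\<close> arbitrarily;
  multiplying \<open>H y = M G^T z\<close> by \<open>G\<close> forces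
  \<open>z = (G M G^T)^(-1) y\<close>, which is linear in \<open>y\<close>.\<close>

lemma right_inverse_weighted_iff:
  fixes G :: "real^'n^'m"
  assumes M: "spd M" and GH: "G ** H = mat 1"
  shows "(\<forall>y. matrix_inv M *v (H *v y) \<in> range (\<lambda>z. transpose G *v z)) \<longleftrightarrow>
    H = M ** transpose G ** matrix_inv (G ** M ** transpose G)"
proof
  note invM = matrix_inv_invertible[OF invertible_spd[OF M]]
  let ?W = "G ** M ** transpose G"
  note invW = matrix_inv_invertible[OF invertible_spd[OF spd_congruence[OF M GH]]]
  {
    assume range: "\<forall>y. matrix_inv M *v (H *v y) \<in> range (\<lambda>z. transpose G *v z)"
    have "H *v y = (M ** transpose G ** matrix_inv ?W) *v y" for y
    proof -
      obtain z where z: "matrix_inv M *v (H *v y) = transpose G *v z" using range by blast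
      have "H *v y = M *v (matrix_inv M *v (H *v y))"
        by (simp only: matrix_vector_mul_assoc invM matrix_vector_mul_lid matrix_mul_assoc matrix_mul_lid)
      also have "\<dots> = M *v (transpose G *v z)" by (simp only: z)
      finally have H: "H *v y = M *v (transpose G *v z)" .
      have "y = G *v (H *v y)" by (simp only: matrix_vector_mul_assoc GH matrix_vector_mul_lid)
      also have "\<dots> = ?W *v z" by (simp only: H matrix_vector_mul_assoc matrix_mul_assoc)
      finally have "matrix_inv ?W *v y = z"
        by (simp only: matrix_vector_mul_assoc invW matrix_vector_mul_lid)
      then show ?thesis by (simp only: H matrix_vector_mul_assoc[symmetric])
    qed
    then show "H = M ** transpose G ** matrix_inv ?W" unfolding matrix_eq by blast
  }
  assume H: "H = M ** transpose G ** matrix_inv ?W"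
  have "matrix_inv M ** H = matrix_inv M ** (M ** transpose G ** matrix_inv ?W)"
    by (rule arg_cong[OF H])
  also have "\<dots> = transpose G ** matrix_inv ?W"
    by (simp only: matrix_mul_assoc invM matrix_mul_lid)
  finally have "matrix_inv M *v (H *v y) = transpose G *v (matrix_inv ?W *v y)" for y
    by (simp only: matrix_vector_mul_assoc)
  then show "\<forall>y. matrix_inv M *v (H *v y) \<in> range (\<lambda>z. transpose G *v z)" by blast
qed

theorem theorem3:
  fixes x :: "'n::{card2, linorder} config"
    and pO :: "real^3" and vO :: vec6 and v :: "'n vec6N"
    and M C :: "'n mat6N" and g :: "'n vec6N"
    and MO CO :: mat6 and gO :: vec6
    and Gstar :: "real^(3 + 3)^('n \<times> (3 + 3))"
  defines "G \<equiv> grasp x pO"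
  defines "dG \<equiv> grasp_dot x pO v vO"
  assumes "CARD('n) \<ge> 3"
    and "x \<in> SE3" and "x \<in> distinct_pos" and "nondegenerate x"
    and "spd M" and "spd MO"
    and "v = transpose G *v vO"
    and "G ** Gstar = mat 1"
  shows "(\<forall>hOd dv dvO u.
            grasp_dynamics M C g MO CO gO G dG v vO dv dvO u (Gstar *v hOd)
              \<longrightarrow> internal_force M C g x v u = 0)
         \<longleftrightarrow> Gstar = M ** transpose G ** matrix_inv (G ** M ** transpose G)"
proof -
  have "internal_force M C g x v u = 0 \<longleftrightarrow> rigidity x *v (matrix_inv M *v h) = 0"
    if "grasp_dynamics M C g MO CO gO G dG v vO dv dvO u h" for dv dvO u h
    by (rule internal_force_grasp_dynamics[OF assms(4,5,7,9)[unfolded G_def] that[unfolded G_def dG_def]])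
  then have "(\<forall>dv dvO u. grasp_dynamics M C g MO CO gO G dG v vO dv dvO u h
            \<longrightarrow> internal_force M C g x v u = 0)
      \<longleftrightarrow> rigidity x *v (matrix_inv M *v h) = 0" for h
    using grasp_dynamics_solvable[OF assms(8), of M C g CO gO G dG v vO h] by blast
  then have "(\<forall>hOd dv dvO u. grasp_dynamics M C g MO CO gO G dG v vO dv dvO u (Gstar *v hOd)
              \<longrightarrow> internal_force M C g x v u = 0)
      \<longleftrightarrow> (\<forall>hOd. rigidity x *v (matrix_inv M *v (Gstar *v hOd)) = 0)"
    by blast
  also have "\<dots> \<longleftrightarrow> (\<forall>hOd. matrix_inv M *v (Gstar *v hOd) \<in> range (\<lambda>z. transpose G *v z))"
    using nondegenerate_kernel_rigidity[OF assms(3,4,6) assms(10)[unfolded G_def]]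
    unfolding G_def by blast
  also have "\<dots> \<longleftrightarrow> Gstar = M ** transpose G ** matrix_inv (G ** M ** transpose G)"
    by (rule right_inverse_weighted_iff[OF assms(7,10)])
  finally show ?thesis .
qed

end
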